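(* Let $\mathcal{E}=\tilde f-f$ be the error process. For fixed $(x^{(1)},x^{(2)})\in\mathbb{R}^D\times\mathbb{R}^D$, write $v=x^{(1)}-z^*$ and $w=x^{(2)}-z^*$. The pointwise error $\mathcal{E}(x^{(1)},x^{(2)})\in L^2(\Omega)$ is a mean-zero Gaussian random variable with variance $$\begin{aligned}\sigma^2_{\mathcal{E}}(x^{(1)},x^{(2)})={}&2\Big(h(0)-h\big(2\|v-w\|_2^2\big)\Big)-4\Big(h'(0)-2h'\big(\|v\|_2^2+\|w\|_2^2\big)\Big)\|v-w\|_2^2\\&+4\Big(h''(0)-2h''\big(\|v\|_2^2+\|w\|_2^2\big)\Big)\|v-w\|_2^2\,\|v+w\|_2^2.\end{aligned}$$
   Context: Let $D\ge 1$ and write points of $\mathbb{R}^D\times\mathbb{R}^D$ as $x=(x^{(1)},x^{(2)})$, with $x^{flip}=(x^{(2)},x^{(1)})$. A real-valued random field is Gaussian if every finite linear combination of its values is a (possibly degenerate) Gaussian random variable. Let $u$ be a mean-zero isotropic Gaussian field on $\mathbb{R}^D\times\mathbb{R}^D$ with covariance function $k_u(x,y)=h(\|x-y\|_2^2)$, where $h:[0,\infty)\to\mathbb{R}$. The field $f(x)=u(x)-u(x^{flip})$ is called a block isotropic Gaussian field with base field $u$; its covariance function is denoted $k_f$. Standing smoothness assumption: $k_u$ (hence $k_f$) is four times continuously differentiable, and $h$ is twice continuously differentiable on $[0,\infty)$. Derivatives of $f$ are taken in the mean-square ($L^2(\Omega)$) sense. Fix $z^*\in\mathbb{R}^D$ and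 $z=(z^*,z^* )$. Define $$g_i=\partial_{x^{(1)}_i}f(x)\big|_{x=z},\quad H^{(1,1)}_{i,j}=\partial_{x^{(1)}_i}\partial_{x^{(1)}_j}f(x)\big|_{x=z},\quad H^{(1,2)}_{i,j}=\partial_{x^{(1)}_i}\partial_{x^{(2)}_j}f(x)\big|_{x=z}.$$ The second-order (skew-symmetric) Taylor approximation of $f$ at $z$ is $$\tilde f(x)=g^{\mathsf T}(v-w)+\tfrac12\big(v^{\mathsf T}H^{(1,1)}v-w^{\mathsf T}H^{(1,1)}w\big)+v^{\mathsf T}H^{(1,2)}w,\qquad v=x^{(1)}-z^*,\ w=x^{(2)}-z^*.$$ *)

theory Defs
  imports "HOL-Probability.Probability"
begin

section \<open>Gaussian random variables and fields\<close>

text \<open>The first disjunct is the degenerate case of zero variance.\<close>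

definition gaussian_rv :: "'w measure \<Rightarrow> ('w \<Rightarrow> real) \<Rightarrow> bool" where
  "gaussian_rv M X \<longleftrightarrow> X \<in> borel_measurable M \<and>
     ((\<exists>\<mu>. AE \<omega> in M. X \<omega> = \<mu>) \<or>
      (\<exists>\<mu> \<sigma>. \<sigma> > 0 \<and> distributed M lborel X (normal_density \<mu> \<sigma>)))"

definition gaussian_field :: "'w measure \<Rightarrow> ('x \<Rightarrow> 'w \<Rightarrow> real) \<Rightarrow> bool" where
  "gaussian_field M F \<longleftrightarrow>
     (\<forall>S c. finite S \<longrightarrow> gaussian_rv M (\<lambda>\<omega>. \<Sum>x\<in>S. c x * F x \<omega>))"

definition covariance :: "'w measure \<Rightarrow> ('w \<Rightarrow> real) \<Rightarrow> ('w \<Rightarrow> real) \<Rightarrow> real" where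
  "covariance M X Y = prob_space.expectation M
     (\<lambda>\<omega>. (X \<omega> - prob_space.expectation M X) * (Y \<omega> - prob_space.expectation M Y))"

definition block_field :: "('p \<times> 'p \<Rightarrow> 'w \<Rightarrow> real) \<Rightarrow> 'p \<times> 'p \<Rightarrow> 'w \<Rightarrow> real" where
  "block_field u x \<omega> = u x \<omega> - u (prod.swap x) \<omega>"


section \<open>Smoothness of functions\<close>

text \<open>On a finite-dimensional domain this is membership in the class \<open>C\<^sup>k\<close>.\<close>

primrec cont_differentiable :: "nat \<Rightarrow> ('a::real_normed_vector \<Rightarrow> real) \<Rightarrow> bool" where
  "cont_differentiable 0 f \<longleftrightarrow> continuous_on UNIV f"
| "cont_differentiable (Suc k) f \<longleftrightarrow>
     (\<forall>x. f differentiable (at x)) \<and>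
     (\<forall>e. cont_differentiable k (\<lambda>x. frechet_derivative f (at x) e))"


section \<open>Mean-square derivatives\<close>

definition sq_integrable :: "'w measure \<Rightarrow> ('w \<Rightarrow> real) \<Rightarrow> bool" where
  "sq_integrable M X \<longleftrightarrow> X \<in> borel_measurable M \<and> integrable M (\<lambda>\<omega>. (X \<omega>)\<^sup>2)"

text \<open>Square integrability of the approximants is required because the Bochner integral of a
  non-integrable function is 0, which would make the limit below meaningless.\<close>

definition ms_tendsto ::
    "'w measure \<Rightarrow> ('t \<Rightarrow> 'w \<Rightarrow> real) \<Rightarrow> ('w \<Rightarrow> real) \<Rightarrow> 't filter \<Rightarrow> bool" where
  "ms_tendsto M X Y l \<longleftrightarrow> sq_integrable M Y \<and> (\<forall>\<^sub>F t in l. sq_integrable M (X t)) \<and>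
     ((\<lambda>t. prob_space.expectation M (\<lambda>\<omega>. (X t \<omega> - Y \<omega>)\<^sup>2)) \<longlongrightarrow> 0) l"

definition has_ms_derivative ::
    "'w measure \<Rightarrow> ('a::real_vector \<Rightarrow> 'w \<Rightarrow> real) \<Rightarrow> 'a \<Rightarrow> 'a \<Rightarrow> ('w \<Rightarrow> real) \<Rightarrow> bool" where
  "has_ms_derivative M F e x Y \<longleftrightarrow>
     ms_tendsto M (\<lambda>t \<omega>. (F (x + t *\<^sub>R e) \<omega> - F x \<omega>) / t) Y (at (0::real))"

text \<open>The mean-square derivative in direction \<open>e\<close> is determined almost surely;
  \<open>ms_deriv\<close> picks one version at each point.\<close>

definition ms_deriv ::
    "'w measure \<Rightarrow> 'a \<Rightarrow> ('a::real_vector \<Rightarrow> 'w \<Rightarrow> real) \<Rightarrow> 'a \<Rightarrow> 'w \<Rightarrow> real" where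
  "ms_deriv M e F x = (SOME Y. has_ms_derivative M F e x Y)"

definition dir1 :: "'n::finite \<Rightarrow> (real^'n) \<times> (real^'n)" where
  "dir1 i = (axis i 1, 0)"

definition dir2 :: "'n::finite \<Rightarrow> (real^'n) \<times> (real^'n)" where
  "dir2 i = (0, axis i 1)"


section \<open>The skew-symmetric second-order Taylor approximation\<close>

context
  fixes M :: "'w measure" and f :: "(real^'n::finite) \<times> (real^'n) \<Rightarrow> 'w \<Rightarrow> real"
    and zs :: "real^'n"
begin

definition grad1 :: "'w \<Rightarrow> real^'n" where
  "grad1 \<omega> = (\<chi> i. ms_deriv M (dir1 i) f (zs, zs) \<omega>)"

definition hess11 :: "'w \<Rightarrow> real^'n^'n" where
  "hess11 \<omega> = (\<chi> i j. ms_deriv M (dir1 i) (ms_deriv M (dir1 j) f) (zs, zs) \<omega>)"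

definition hess12 :: "'w \<Rightarrow> real^'n^'n" where
  "hess12 \<omega> = (\<chi> i j. ms_deriv M (dir1 i) (ms_deriv M (dir2 j) f) (zs, zs) \<omega>)"

definition skew_taylor2 :: "(real^'n) \<times> (real^'n) \<Rightarrow> 'w \<Rightarrow> real" where
  "skew_taylor2 x \<omega> =
     (let v = fst x - zs; w = snd x - zs in
        grad1 \<omega> \<bullet> (v - w)
        + 1/2 * (v \<bullet> (hess11 \<omega> *v v) - w \<bullet> (hess11 \<omega> *v w))
        + v \<bullet> (hess12 \<omega> *v w))"

definition taylor_error :: "(real^'n) \<times> (real^'n) \<Rightarrow> 'w \<Rightarrow> real" where
  "taylor_error x \<omega> = skew_taylor2 x \<omega> - f x \<omega>"

end

end

theory Submission
  imports Defs
begin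

text \<open>Write \<open>z\<close> for the diagonal base point, \<open>e = (v, w)\<close> for the displacement and \<open>e' = (w, v)\<close> for its
swap. Since \<open>f (z + t e) = u (z + t e) - u (z + t e')\<close>, the second-order Taylor polynomial of \<open>f\<close> at
\<open>z\<close> equals, almost surely,
\<open>D\<^sub>a u(z) + 1/2 D\<^sub>a D\<^sub>b u(z)\<close> with \<open>a = e - e' = (v - w, w - v)\<close> and \<open>b = e + e' = (v + w, v + w)\<close>,
where \<open>D\<close> denotes directional mean-square derivatives of the base field. The vectors \<open>a\<close> and \<open>b\<close> are
orthogonal. Hence the error is a linear combination of \<open>D\<^sub>a u(z)\<close>, \<open>D\<^sub>a D\<^sub>b u(z)\<close>, \<open>u(x)\<close> and the value of
\<open>u\<close> at the flipped point, and the variance formula is the expansion of its square. The covariances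
that enter are derivatives of \<open>h (\<parallel>x - y\<parallel>\<^sup>2)\<close>:
\<open>E[(D\<^sub>a u)\<^sup>2] = - 2 h'(0) \<parallel>a\<parallel>\<^sup>2\<close>, and, by orthogonality,
\<open>E[(D\<^sub>a D\<^sub>b u)\<^sup>2] = 4 h''(0) \<parallel>a\<parallel>\<^sup>2 \<parallel>b\<parallel>\<^sup>2\<close>; the first and second derivatives
at \<open>z\<close> are uncorrelated by parity, and the covariances with \<open>u\<close> at distant points are first and
second derivatives of \<open>h (\<parallel>x - y\<parallel>\<^sup>2)\<close> (lemmas \<open>inner_D1_u\<close>, \<open>inner_D1_D1\<close>, \<open>inner_D2_u\<close>,
\<open>inner_D2_D1_same\<close>, \<open>inner_D2_D2_same\<close>).

Three points need an argument beyond this computation.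

The derivatives must exist. For a field with a \<open>C\<^sup>2\<close> covariance kernel the covariances of difference
quotients converge to the mixed derivative of the kernel, so the quotients are Cauchy in \<open>L\<^sup>2\<close>
(\<open>ms_derivative_exists\<close>); the derivative field has the mixed derivative as its kernel, and for a \<open>C\<^sup>4\<close>
kernel the step can be repeated (\<open>cont_differentiable_covariance_ms_deriv\<close>).

The derivatives are arbitrary versions, chosen for each coordinate direction. That the coordinate
expression of the Taylor polynomial assembles into directional derivatives is therefore an almost
sure statement; it is deduced from the covariances, because a linear combination orthogonal to all
of its generators vanishes almost surely (\<open>l2_span_orthogonal_AE_zero\<close>). The same argument gives
the symmetry of second derivatives.

Gaussianity holds because the error lies in the \<open>L\<^sup>2\<close>-closed linear span of the values of \<open>u\<close>, and
characteristic functions pass to mean-square limits (\<open>gaussian_closed_span\<close>).\<close>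

section \<open>The inner product of square-integrable random variables\<close>

text \<open>This is the \<open>L\<^sup>2\<close> inner product only on square-integrable arguments; elsewhere the
Bochner integral may be the meaningless value 0, so its bilinearity is conditional.\<close>
definition l2_inner :: "'w measure \<Rightarrow> ('w \<Rightarrow> real) \<Rightarrow> ('w \<Rightarrow> real) \<Rightarrow> real" where
  "l2_inner M X Y = integral\<^sup>L M (\<lambda>\<omega>. X \<omega> * Y \<omega>)"

lemma l2_inner_commute: "l2_inner M X Y = l2_inner M Y X"
  by (simp add: l2_inner_def mult.commute)

lemma l2_inner_scale_left: "l2_inner M (\<lambda>\<omega>. c * X \<omega>) Y = c * l2_inner M X Y"
  by (simp add: l2_inner_def mult.assoc)

lemma l2_inner_scale_right: "l2_inner M Y (\<lambda>\<omega>. c * X \<omega>) = c * l2_inner M Y X"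
  by (simp only: l2_inner_commute[of M Y] l2_inner_scale_left)

lemma sq_integrable_measurable: "sq_integrable M X \<Longrightarrow> X \<in> borel_measurable M"
  by (simp add: sq_integrable_def)

lemma sq_integrable_mult:
  assumes "sq_integrable M X" "sq_integrable M Y"
  shows "integrable M (\<lambda>\<omega>. X \<omega> * Y \<omega>)"
proof (rule Bochner_Integration.integrable_bound)
  show "integrable M (\<lambda>\<omega>. (X \<omega>)\<^sup>2 + (Y \<omega>)\<^sup>2)"
    using assms by (simp add: sq_integrable_def)
  have [measurable]: "X \<in> borel_measurable M" "Y \<in> borel_measurable M"
    using assms by (auto simp: sq_integrable_def)
  show "(\<lambda>\<omega>. X \<omega> * Y \<omega>) \<in> borel_measurable M" by measurable
  have "\<bar>a * b\<bar> \<le> a\<^sup>2 + b\<^sup>2" for a b :: real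
    using sum_squares_bound[of "\<bar>a\<bar>" "\<bar>b\<bar>"] abs_ge_zero[of "a * b"]
    unfolding abs_mult power2_abs by linarith
  then show "AE \<omega> in M. norm (X \<omega> * Y \<omega>) \<le> norm ((X \<omega>)\<^sup>2 + (Y \<omega>)\<^sup>2)" by auto
qed

lemma sq_integrable_zero [simp]: "sq_integrable M (\<lambda>_. 0)"
  by (simp add: sq_integrable_def)

lemma sq_integrable_scale [simp]:
  "sq_integrable M X \<Longrightarrow> sq_integrable M (\<lambda>\<omega>. c * X \<omega>)"
  by (auto simp: sq_integrable_def power_mult_distrib)

lemma sq_integrable_add [simp]:
  assumes "sq_integrable M X" "sq_integrable M Y"
  shows "sq_integrable M (\<lambda>\<omega>. X \<omega> + Y \<omega>)"
proof -
  have "integrable M (\<lambda>\<omega>. (X \<omega>)\<^sup>2 + (Y \<omega>)\<^sup>2 + 2 * (X \<omega> * Y \<omega>))"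
    using assms sq_integrable_mult[OF assms]
    by (intro Bochner_Integration.integrable_add integrable_mult_right) (simp_all add: sq_integrable_def)
  moreover have "(\<lambda>\<omega>. (X \<omega> + Y \<omega>)\<^sup>2) = (\<lambda>\<omega>. (X \<omega>)\<^sup>2 + (Y \<omega>)\<^sup>2 + 2 * (X \<omega> * Y \<omega>))"
    by (simp add: power2_sum mult.assoc)
  ultimately show ?thesis
    using assms unfolding sq_integrable_def by (simp add: borel_measurable_add)
qed

lemma sq_integrable_diff [simp]:
  assumes "sq_integrable M X" "sq_integrable M Y"
  shows "sq_integrable M (\<lambda>\<omega>. X \<omega> - Y \<omega>)"
  using sq_integrable_add[OF assms(1) sq_integrable_scale[OF assms(2), of "-1"]] by simp

lemma sq_integrable_sum [simp]:
  "(\<And>i. i \<in> I \<Longrightarrow> sq_integrable M (X i)) \<Longrightarrow> sq_integrable M (\<lambda>\<omega>. \<Sum>i\<in>I. X i \<omega>)"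
  by (induction I rule: infinite_finite_induct) auto

lemma sq_integrable_divide [simp]:
  "sq_integrable M X \<Longrightarrow> sq_integrable M (\<lambda>\<omega>. X \<omega> / c)"
  using sq_integrable_scale[of M X "inverse c"] by (simp add: field_simps)

lemma l2_inner_add_left:
  "sq_integrable M X \<Longrightarrow> sq_integrable M Y \<Longrightarrow> sq_integrable M Z \<Longrightarrow>
   l2_inner M (\<lambda>\<omega>. X \<omega> + Y \<omega>) Z = l2_inner M X Z + l2_inner M Y Z"
  unfolding l2_inner_def distrib_right
  by (intro Bochner_Integration.integral_add sq_integrable_mult)

lemma l2_inner_diff_left:
  "sq_integrable M X \<Longrightarrow> sq_integrable M Y \<Longrightarrow> sq_integrable M Z \<Longrightarrow>
   l2_inner M (\<lambda>\<omega>. X \<omega> - Y \<omega>) Z = l2_inner M X Z - l2_inner M Y Z"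
  unfolding l2_inner_def left_diff_distrib
  by (intro Bochner_Integration.integral_diff sq_integrable_mult)

lemma l2_inner_sum_left:
  "(\<And>i. i \<in> I \<Longrightarrow> sq_integrable M (X i)) \<Longrightarrow> sq_integrable M Z \<Longrightarrow>
   l2_inner M (\<lambda>\<omega>. \<Sum>i\<in>I. X i \<omega>) Z = (\<Sum>i\<in>I. l2_inner M (X i) Z)"
  unfolding l2_inner_def sum_distrib_right
  by (intro Bochner_Integration.integral_sum sq_integrable_mult)

lemma l2_inner_add_right:
  "sq_integrable M X \<Longrightarrow> sq_integrable M Y \<Longrightarrow> sq_integrable M Z \<Longrightarrow>
   l2_inner M Z (\<lambda>\<omega>. X \<omega> + Y \<omega>) = l2_inner M Z X + l2_inner M Z Y"
  by (simp add: l2_inner_commute[of M Z] l2_inner_add_left)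

lemma l2_inner_diff_right:
  "sq_integrable M X \<Longrightarrow> sq_integrable M Y \<Longrightarrow> sq_integrable M Z \<Longrightarrow>
   l2_inner M Z (\<lambda>\<omega>. X \<omega> - Y \<omega>) = l2_inner M Z X - l2_inner M Z Y"
  by (simp add: l2_inner_commute[of M Z] l2_inner_diff_left)

lemma l2_inner_sum_right:
  "(\<And>i. i \<in> I \<Longrightarrow> sq_integrable M (X i)) \<Longrightarrow> sq_integrable M Z \<Longrightarrow>
   l2_inner M Z (\<lambda>\<omega>. \<Sum>i\<in>I. X i \<omega>) = (\<Sum>i\<in>I. l2_inner M Z (X i))"
  by (simp add: l2_inner_commute[of M Z] l2_inner_sum_left)

lemma l2_inner_divide_left: "l2_inner M (\<lambda>\<omega>. X \<omega> / c) Y = l2_inner M X Y / c"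
  using l2_inner_scale_left[of M "inverse c" X Y] by (simp add: field_simps)

lemma l2_inner_divide_right: "l2_inner M Y (\<lambda>\<omega>. X \<omega> / c) = l2_inner M Y X / c"
  using l2_inner_scale_right[of M Y "inverse c" X] by (simp add: field_simps)

lemmas l2_inner_bilinear =
  l2_inner_add_left l2_inner_add_right l2_inner_diff_left l2_inner_diff_right
  l2_inner_scale_left l2_inner_scale_right l2_inner_divide_left l2_inner_divide_right

lemma l2_inner_self_nonneg [simp]: "0 \<le> l2_inner M X X"
  by (simp add: l2_inner_def)

lemma l2_inner_self_eq_0_AE:
  assumes "sq_integrable M X" "l2_inner M X X = 0"
  shows "AE \<omega> in M. X \<omega> = 0"
proof -
  have "AE \<omega> in M. X \<omega> * X \<omega> = 0"
    using assms sq_integrable_mult[OF assms(1) assms(1)]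
    by (subst (asm) l2_inner_def) (simp add: integral_nonneg_eq_0_iff_AE)
  then show ?thesis by simp
qed

lemma l2_inner_cong_AE:
  assumes "AE \<omega> in M. X \<omega> = X' \<omega>" "AE \<omega> in M. Y \<omega> = Y' \<omega>"
    "sq_integrable M X" "sq_integrable M X'" "sq_integrable M Y" "sq_integrable M Y'"
  shows "l2_inner M X Y = l2_inner M X' Y'"
  unfolding l2_inner_def
proof (rule integral_cong_AE)
  show "(\<lambda>\<omega>. X \<omega> * Y \<omega>) \<in> borel_measurable M" "(\<lambda>\<omega>. X' \<omega> * Y' \<omega>) \<in> borel_measurable M"
    using assms by (auto intro!: borel_measurable_integrable sq_integrable_mult)
  show "AE \<omega> in M. X \<omega> * Y \<omega> = X' \<omega> * Y' \<omega>"
    using assms(1,2) by eventually_elim simp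
qed

text \<open>The quadratic \<open>s \<mapsto> \<parallel>X + s Y\<parallel>\<^sup>2\<close> is nonnegative, so its discriminant is not positive.\<close>
lemma l2_cauchy_schwarz:
  assumes "sq_integrable M X" "sq_integrable M Y"
  shows "(l2_inner M X Y)\<^sup>2 \<le> l2_inner M X X * l2_inner M Y Y"
proof -
  let ?a = "l2_inner M X X" and ?b = "l2_inner M X Y" and ?c = "l2_inner M Y Y"
  have q: "0 \<le> ?a + 2 * s * ?b + s\<^sup>2 * ?c" for s
  proof -
    have "0 \<le> l2_inner M (\<lambda>\<omega>. X \<omega> + s * Y \<omega>) (\<lambda>\<omega>. X \<omega> + s * Y \<omega>)" by simp
    also have "\<dots> = ?a + 2 * s * ?b + s\<^sup>2 * ?c"
      using assms by (simp add: l2_inner_bilinear l2_inner_commute[of M Y X] power2_eq_square algebra_simps)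
    finally show ?thesis .
  qed
  show ?thesis
  proof (cases "?c = 0")
    case True
    have "?b = 0"
    proof (rule ccontr)
      assume b: "?b \<noteq> 0"
      (* a nonconstant affine function of s takes the value -1 *)
      have "0 \<le> ?a + 2 * (- (?a + 1) / (2 * ?b)) * ?b" using q[of "- (?a + 1) / (2 * ?b)"] True by simp
      then show False using b by (simp add: field_simps)
    qed
    then show ?thesis by simp
  next
    case False
    then have c: "?c > 0" using l2_inner_self_nonneg[of M Y] by linarith
    have "0 \<le> ?a - ?b\<^sup>2 / ?c"
      using q[of "- ?b / ?c"] c by (simp add: field_simps power2_eq_square)
    then show ?thesis using c by (simp add: field_simps)
  qed
qed

text \<open>The parallelogram law gives a triangle inequality for the squared distance, with factor 2 and no
square roots.\<close>
lemma l2_inner_diff_triangle: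
  assumes "sq_integrable M X" "sq_integrable M Y" "sq_integrable M Z"
  shows "l2_inner M (\<lambda>\<omega>. X \<omega> - Z \<omega>) (\<lambda>\<omega>. X \<omega> - Z \<omega>) \<le>
    2 * l2_inner M (\<lambda>\<omega>. X \<omega> - Y \<omega>) (\<lambda>\<omega>. X \<omega> - Y \<omega>) +
    2 * l2_inner M (\<lambda>\<omega>. Y \<omega> - Z \<omega>) (\<lambda>\<omega>. Y \<omega> - Z \<omega>)"
proof -
  have "0 \<le> l2_inner M (\<lambda>\<omega>. (X \<omega> - Y \<omega>) - (Y \<omega> - Z \<omega>)) (\<lambda>\<omega>. (X \<omega> - Y \<omega>) - (Y \<omega> - Z \<omega>))" by simp
  then show ?thesis
    using assms by (simp del: l2_inner_self_nonneg add: l2_inner_bilinear l2_inner_commute[of M Y X]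
        l2_inner_commute[of M Z X] l2_inner_commute[of M Z Y])
qed

section \<open>Calculus of mean-square limits\<close>

lemma ms_tendsto_iff:
  "ms_tendsto M X Y l \<longleftrightarrow> sq_integrable M Y \<and> (\<forall>\<^sub>F t in l. sq_integrable M (X t)) \<and>
    ((\<lambda>t. l2_inner M (\<lambda>\<omega>. X t \<omega> - Y \<omega>) (\<lambda>\<omega>. X t \<omega> - Y \<omega>)) \<longlongrightarrow> 0) l"
  by (simp add: ms_tendsto_def l2_inner_def power2_eq_square)

lemma ms_tendsto_sq_integrable: "ms_tendsto M X Y l \<Longrightarrow> sq_integrable M Y"
  by (simp add: ms_tendsto_def)

lemma ms_tendsto_scale:
  assumes "ms_tendsto M X Y l"
  shows "ms_tendsto M (\<lambda>t \<omega>. c * X t \<omega>) (\<lambda>\<omega>. c * Y \<omega>) l"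
proof -
  have eq: "(\<lambda>\<omega>. c * X t \<omega> - c * Y \<omega>) = (\<lambda>\<omega>. c * (X t \<omega> - Y \<omega>))" for t
    by (simp add: algebra_simps)
  have "((\<lambda>t. c * (c * l2_inner M (\<lambda>\<omega>. X t \<omega> - Y \<omega>) (\<lambda>\<omega>. X t \<omega> - Y \<omega>))) \<longlongrightarrow> c * (c * 0)) l"
    using assms by (intro tendsto_mult_left) (simp add: ms_tendsto_iff)
  then show ?thesis
    using assms by (auto simp: ms_tendsto_iff eq l2_inner_scale_left l2_inner_scale_right
        elim: eventually_mono)
qed

lemma ms_tendsto_add:
  assumes X: "ms_tendsto M X X' l" and Y: "ms_tendsto M Y Y' l"
  shows "ms_tendsto M (\<lambda>t \<omega>. X t \<omega> + Y t \<omega>) (\<lambda>\<omega>. X' \<omega> + Y' \<omega>) l"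
proof -
  let ?dX = "\<lambda>t \<omega>. X t \<omega> - X' \<omega>" and ?dY = "\<lambda>t \<omega>. Y t \<omega> - Y' \<omega>"
  have sq: "sq_integrable M X'" "sq_integrable M Y'"
    and evX: "\<forall>\<^sub>F t in l. sq_integrable M (X t)" and evY: "\<forall>\<^sub>F t in l. sq_integrable M (Y t)"
    using X Y by (auto simp: ms_tendsto_def)
  have "((\<lambda>t. 2 * l2_inner M (?dX t) (?dX t) + 2 * l2_inner M (?dY t) (?dY t)) \<longlongrightarrow> 2 * 0 + 2 * 0) l"
    using X Y by (intro tendsto_intros) (auto simp: ms_tendsto_iff)
  then have lim: "((\<lambda>t. 2 * l2_inner M (?dX t) (?dX t) + 2 * l2_inner M (?dY t) (?dY t)) \<longlongrightarrow> 0) l" by simp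
  let ?s = "\<lambda>t \<omega>. (X t \<omega> + Y t \<omega>) - (X' \<omega> + Y' \<omega>)"
  have bound: "\<forall>\<^sub>F t in l. l2_inner M (?s t) (?s t) \<le>
      2 * l2_inner M (?dX t) (?dX t) + 2 * l2_inner M (?dY t) (?dY t)"
    using evX evY
  proof eventually_elim
    case (elim t)
    have "l2_inner M (?s t) (?s t) \<le>
        2 * l2_inner M (\<lambda>\<omega>. (X t \<omega> + Y t \<omega>) - (X' \<omega> + Y t \<omega>)) (\<lambda>\<omega>. (X t \<omega> + Y t \<omega>) - (X' \<omega> + Y t \<omega>)) +
        2 * l2_inner M (\<lambda>\<omega>. (X' \<omega> + Y t \<omega>) - (X' \<omega> + Y' \<omega>)) (\<lambda>\<omega>. (X' \<omega> + Y t \<omega>) - (X' \<omega> + Y' \<omega>))"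
      by (rule l2_inner_diff_triangle) (use elim sq in auto)
    then show ?case by simp
  qed
  have "((\<lambda>t. l2_inner M (?s t) (?s t)) \<longlongrightarrow> 0) l"
    by (rule tendsto_sandwich[OF _ bound tendsto_const lim]) simp
  then show ?thesis
    using sq eventually_elim2[OF evX evY, of "\<lambda>t. sq_integrable M (\<lambda>\<omega>. X t \<omega> + Y t \<omega>)"]
    by (simp add: ms_tendsto_iff)
qed

lemma ms_tendsto_diff:
  assumes "ms_tendsto M X X' l" "ms_tendsto M Y Y' l"
  shows "ms_tendsto M (\<lambda>t \<omega>. X t \<omega> - Y t \<omega>) (\<lambda>\<omega>. X' \<omega> - Y' \<omega>) l"
  using ms_tendsto_add[OF assms(1) ms_tendsto_scale[OF assms(2), of "-1"]] by simp

lemma ms_tendsto_inner_left: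
  assumes X: "ms_tendsto M X X' l" and Z: "sq_integrable M Z"
  shows "((\<lambda>t. l2_inner M (X t) Z) \<longlongrightarrow> l2_inner M X' Z) l"
proof -
  let ?d = "\<lambda>t \<omega>. X t \<omega> - X' \<omega>"
  have sq: "sq_integrable M X'" and ev: "\<forall>\<^sub>F t in l. sq_integrable M (X t)"
    using X by (auto simp: ms_tendsto_def)
  have "((\<lambda>t. sqrt (l2_inner M (?d t) (?d t) * l2_inner M Z Z)) \<longlongrightarrow> sqrt (0 * l2_inner M Z Z)) l"
    using X by (intro tendsto_intros) (auto simp: ms_tendsto_iff)
  then have lim: "((\<lambda>t. sqrt (l2_inner M (?d t) (?d t) * l2_inner M Z Z)) \<longlongrightarrow> 0) l" by simp
  have bound: "\<forall>\<^sub>F t in l. norm (l2_inner M (X t) Z - l2_inner M X' Z) \<le>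
      sqrt (l2_inner M (?d t) (?d t) * l2_inner M Z Z)"
    using ev
  proof eventually_elim
    case (elim t)
    have "l2_inner M (X t) Z - l2_inner M X' Z = l2_inner M (?d t) Z"
      using elim sq Z by (simp add: l2_inner_bilinear)
    moreover have "(l2_inner M (?d t) Z)\<^sup>2 \<le> l2_inner M (?d t) (?d t) * l2_inner M Z Z"
      using elim sq Z by (intro l2_cauchy_schwarz) auto
    ultimately show ?case using real_le_rsqrt[of "\<bar>l2_inner M (?d t) Z\<bar>"] by simp
  qed
  show ?thesis
    using Lim_null_comparison[OF bound lim] by (rule LIM_zero_cancel)
qed

text \<open>Joint continuity of the inner product: covariances of mean-square limits are limits of covariances.
All moments of mean-square derivatives below are obtained through this fact or its one-sided form.\<close>
lemma ms_tendsto_inner: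
  assumes X: "ms_tendsto M X X' l" and Y: "ms_tendsto M Y Y' l"
  shows "((\<lambda>t. l2_inner M (X t) (Y t)) \<longlongrightarrow> l2_inner M X' Y') l"
proof -
  let ?dX = "\<lambda>t \<omega>. X t \<omega> - X' \<omega>" and ?dY = "\<lambda>t \<omega>. Y t \<omega> - Y' \<omega>"
  have sq: "sq_integrable M X'" "sq_integrable M Y'"
    and evX: "\<forall>\<^sub>F t in l. sq_integrable M (X t)" and evY: "\<forall>\<^sub>F t in l. sq_integrable M (Y t)"
    using X Y by (auto simp: ms_tendsto_def)
  have "((\<lambda>t. sqrt (l2_inner M (?dX t) (?dX t) * l2_inner M (?dY t) (?dY t))) \<longlongrightarrow> sqrt (0 * 0)) l"
    using X Y by (intro tendsto_intros) (auto simp: ms_tendsto_iff)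
  then have lim: "((\<lambda>t. sqrt (l2_inner M (?dX t) (?dX t) * l2_inner M (?dY t) (?dY t))) \<longlongrightarrow> 0) l" by simp
  have bound: "\<forall>\<^sub>F t in l. norm (l2_inner M (?dX t) (?dY t)) \<le>
      sqrt (l2_inner M (?dX t) (?dX t) * l2_inner M (?dY t) (?dY t))"
    using evX evY
  proof eventually_elim
    case (elim t)
    have "(l2_inner M (?dX t) (?dY t))\<^sup>2 \<le> l2_inner M (?dX t) (?dX t) * l2_inner M (?dY t) (?dY t)"
      using elim sq by (intro l2_cauchy_schwarz) auto
    then show ?case using real_le_rsqrt[of "\<bar>l2_inner M (?dX t) (?dY t)\<bar>"] by simp
  qed
  have "((\<lambda>t. l2_inner M (?dX t) (?dY t) + l2_inner M (X t) Y' + l2_inner M (Y t) X' - l2_inner M X' Y')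
      \<longlongrightarrow> 0 + l2_inner M X' Y' + l2_inner M Y' X' - l2_inner M X' Y') l"
    by (intro tendsto_intros ms_tendsto_inner_left X Y sq Lim_null_comparison[OF bound lim])
  then have lim2: "((\<lambda>t. l2_inner M (?dX t) (?dY t) + l2_inner M (X t) Y' + l2_inner M (Y t) X' - l2_inner M X' Y')
      \<longlongrightarrow> l2_inner M X' Y') l" by (simp add: l2_inner_commute[of M Y' X'])
  show ?thesis
  proof (rule Lim_transform_eventually[OF lim2])
    show "\<forall>\<^sub>F t in l. l2_inner M (?dX t) (?dY t) + l2_inner M (X t) Y' + l2_inner M (Y t) X' - l2_inner M X' Y'
        = l2_inner M (X t) (Y t)"
      using evX evY
      by eventually_elim (use sq in \<open>simp add: l2_inner_bilinear l2_inner_commute[of M _ X']\<close>)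
  qed
qed

lemma ms_tendsto_unique:
  assumes "ms_tendsto M X Y l" "ms_tendsto M X Z l" "l \<noteq> bot"
  shows "AE \<omega> in M. Y \<omega> = Z \<omega>"
proof -
  have sq: "sq_integrable M Y" "sq_integrable M Z"
    using assms by (auto simp: ms_tendsto_def)
  have "l2_inner M Y W = l2_inner M Z W" if "sq_integrable M W" for W
    using tendsto_unique[OF assms(3)] ms_tendsto_inner_left[OF assms(1) that]
      ms_tendsto_inner_left[OF assms(2) that] by blast
  from this[of "\<lambda>\<omega>. Y \<omega> - Z \<omega>"]
  have "l2_inner M (\<lambda>\<omega>. Y \<omega> - Z \<omega>) (\<lambda>\<omega>. Y \<omega> - Z \<omega>) = 0"
    using sq by (simp add: l2_inner_diff_left)
  then have "AE \<omega> in M. Y \<omega> - Z \<omega> = 0"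
    using sq by (intro l2_inner_self_eq_0_AE) auto
  then show ?thesis by simp
qed

lemma sq_integrable_cong_AE:
  assumes "sq_integrable M X" "AE \<omega> in M. X \<omega> = Y \<omega>" "Y \<in> borel_measurable M"
  shows "sq_integrable M Y"
proof -
  have [measurable]: "X \<in> borel_measurable M" "Y \<in> borel_measurable M"
    using assms by (auto simp: sq_integrable_def)
  have "integrable M (\<lambda>\<omega>. (X \<omega>)\<^sup>2) \<longleftrightarrow> integrable M (\<lambda>\<omega>. (Y \<omega>)\<^sup>2)"
    by (rule integrable_cong_AE) (use assms(2) in auto)
  then show ?thesis using assms by (simp add: sq_integrable_def)
qed

lemma ms_tendsto_cong_AE:
  assumes X: "ms_tendsto M X Y l"
    and eq: "\<And>t. AE \<omega> in M. X t \<omega> = X' t \<omega>" "\<And>t. sq_integrable M (X' t)"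
  shows "ms_tendsto M X' Y l"
proof -
  have sq: "sq_integrable M Y" and evX: "\<forall>\<^sub>F t in l. sq_integrable M (X t)"
    using X by (auto simp: ms_tendsto_def)
  have "\<forall>\<^sub>F t in l. l2_inner M (\<lambda>\<omega>. X t \<omega> - Y \<omega>) (\<lambda>\<omega>. X t \<omega> - Y \<omega>) =
      l2_inner M (\<lambda>\<omega>. X' t \<omega> - Y \<omega>) (\<lambda>\<omega>. X' t \<omega> - Y \<omega>)"
    using evX
  proof eventually_elim
    case (elim t)
    have "AE \<omega> in M. X t \<omega> - Y \<omega> = X' t \<omega> - Y \<omega>" using eq(1)[of t] by auto
    then show ?case
      using elim eq(2)[of t] sq by (intro l2_inner_cong_AE) auto
  qed
  then show ?thesis
    using X eq sq by (auto simp: ms_tendsto_iff elim: Lim_transform_eventually)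
qed

section \<open>Completeness of the space of square-integrable random variables\<close>

context prob_space
begin

lemma sq_integrable_integrable: "sq_integrable M X \<Longrightarrow> integrable M X"
  using sq_integrable_mult[of M X "\<lambda>_. 1"] by (simp add: sq_integrable_def)

lemma l2_abs_expectation_le:
  assumes "sq_integrable M X"
  shows "(\<integral>\<omega>. \<bar>X \<omega>\<bar> \<partial>M) \<le> sqrt (l2_inner M X X)"
proof -
  have [measurable]: "X \<in> borel_measurable M" using assms by (simp add: sq_integrable_def)
  have "sq_integrable M (\<lambda>\<omega>. \<bar>X \<omega>\<bar>)" using assms by (simp add: sq_integrable_def)
  moreover have "sq_integrable M (\<lambda>_. 1)" by (simp add: sq_integrable_def)
  ultimately have "(l2_inner M (\<lambda>\<omega>. \<bar>X \<omega>\<bar>) (\<lambda>_. 1))\<^sup>2 \<le>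
      l2_inner M (\<lambda>\<omega>. \<bar>X \<omega>\<bar>) (\<lambda>\<omega>. \<bar>X \<omega>\<bar>) * l2_inner M (\<lambda>_. 1) (\<lambda>_. 1)"
    by (rule l2_cauchy_schwarz)
  then have "(\<integral>\<omega>. \<bar>X \<omega>\<bar> \<partial>M)\<^sup>2 \<le> l2_inner M X X"
    by (simp add: l2_inner_def prob_space)
  then show ?thesis by (rule real_le_rsqrt)
qed

text \<open>Riesz--Fischer. An \<open>L\<^sup>2\<close>-Cauchy sequence is \<open>L\<^sup>1\<close>-Cauchy on a probability space, so a
subsequence converges almost everywhere; Fatou's lemma applied to the squared differences shows that
the pointwise limit is also the \<open>L\<^sup>2\<close> limit of the full sequence.\<close>
lemma l2_complete:
  assumes sq: "\<And>n. sq_integrable M (S n)"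
    and cauchy: "\<And>\<epsilon>. \<epsilon> > 0 \<Longrightarrow> \<exists>N. \<forall>i\<ge>N. \<forall>j\<ge>N.
      l2_inner M (\<lambda>\<omega>. S i \<omega> - S j \<omega>) (\<lambda>\<omega>. S i \<omega> - S j \<omega>) < \<epsilon>"
  obtains Y where "ms_tendsto M S Y sequentially"
proof -
  have [measurable]: "S n \<in> borel_measurable M" for n
    using sq by (simp add: sq_integrable_def)
  have l1: "\<exists>N. \<forall>i\<ge>N. \<forall>j\<ge>N. (\<integral>\<omega>. norm (S i \<omega> - S j \<omega>) \<partial>M) < e" if e: "e > 0" for e :: real
  proof -
    obtain N where N: "\<forall>i\<ge>N. \<forall>j\<ge>N. l2_inner M (\<lambda>\<omega>. S i \<omega> - S j \<omega>) (\<lambda>\<omega>. S i \<omega> - S j \<omega>) < e\<^sup>2"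
      using cauchy[of "e\<^sup>2"] e by auto
    have "(\<integral>\<omega>. norm (S i \<omega> - S j \<omega>) \<partial>M) < e" if "i \<ge> N" "j \<ge> N" for i j
    proof -
      have "(\<integral>\<omega>. norm (S i \<omega> - S j \<omega>) \<partial>M) \<le> sqrt (l2_inner M (\<lambda>\<omega>. S i \<omega> - S j \<omega>) (\<lambda>\<omega>. S i \<omega> - S j \<omega>))"
        using l2_abs_expectation_le[of "\<lambda>\<omega>. S i \<omega> - S j \<omega>"] sq by simp
      also have "\<dots> < e" using N that e by (intro real_less_lsqrt) auto
      finally show ?thesis .
    qed
    then show ?thesis by blast
  qed
  obtain r where r: "strict_mono r" "AE \<omega> in M. Cauchy (\<lambda>i. S (r i) \<omega>)"
  proof (rule cauchy_L1_AE_cauchy_subseq[of M S])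
    show "integrable M (S n)" for n by (rule sq_integrable_integrable[OF sq])
    show "\<exists>N. \<forall>i\<ge>N. \<forall>j\<ge>N. (\<integral>\<omega>. norm (S i \<omega> - S j \<omega>) \<partial>M) < e" if "e > 0" for e :: real
      using that by (rule l1)
  qed
  define Y where "Y \<omega> = lim (\<lambda>i. S (r i) \<omega>)" for \<omega>
  have [measurable]: "Y \<in> borel_measurable M" unfolding Y_def by measurable
  have lim: "AE \<omega> in M. (\<lambda>i. S (r i) \<omega>) \<longlonglongrightarrow> Y \<omega>"
    using r(2) by (auto simp: Y_def Cauchy_convergent_iff convergent_LIMSEQ_iff)
  have fatou: "(\<integral>\<^sup>+\<omega>. ennreal ((S n \<omega> - Y \<omega>)\<^sup>2) \<partial>M) \<le> ennreal \<epsilon>"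
    if bnd: "\<And>j. j \<ge> N \<Longrightarrow> l2_inner M (\<lambda>\<omega>. S n \<omega> - S j \<omega>) (\<lambda>\<omega>. S n \<omega> - S j \<omega>) < \<epsilon>" for n N \<epsilon>
  proof -
    have "(\<integral>\<^sup>+\<omega>. ennreal ((S n \<omega> - Y \<omega>)\<^sup>2) \<partial>M) = (\<integral>\<^sup>+\<omega>. liminf (\<lambda>k. ennreal ((S n \<omega> - S (r k) \<omega>)\<^sup>2)) \<partial>M)"
    proof (rule nn_integral_cong_AE)
      show "AE \<omega> in M. ennreal ((S n \<omega> - Y \<omega>)\<^sup>2) = liminf (\<lambda>k. ennreal ((S n \<omega> - S (r k) \<omega>)\<^sup>2))"
        using lim
      proof eventually_elim
        case (elim \<omega>)
        have "(\<lambda>k. ennreal ((S n \<omega> - S (r k) \<omega>)\<^sup>2)) \<longlonglongrightarrow> ennreal ((S n \<omega> - Y \<omega>)\<^sup>2)"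
          by (intro tendsto_ennrealI tendsto_intros elim)
        then show ?case by (rule lim_imp_Liminf[OF trivial_limit_sequentially, symmetric])
      qed
    qed
    also have "\<dots> \<le> liminf (\<lambda>k. \<integral>\<^sup>+\<omega>. ennreal ((S n \<omega> - S (r k) \<omega>)\<^sup>2) \<partial>M)"
      by (rule nn_integral_liminf) measurable
    also have "\<dots> \<le> ennreal \<epsilon>"
    proof (rule Liminf_le)
      have "(\<integral>\<^sup>+\<omega>. ennreal ((S n \<omega> - S (r k) \<omega>)\<^sup>2) \<partial>M) \<le> ennreal \<epsilon>" if "k \<ge> N" for k
      proof -
        have "r k \<ge> N" using that seq_suble[OF r(1), of k] by simp
        moreover have "(\<integral>\<^sup>+\<omega>. ennreal ((S n \<omega> - S (r k) \<omega>)\<^sup>2) \<partial>M) =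
            ennreal (l2_inner M (\<lambda>\<omega>. S n \<omega> - S (r k) \<omega>) (\<lambda>\<omega>. S n \<omega> - S (r k) \<omega>))"
          using sq_integrable_diff[OF sq[of n] sq[of "r k"]]
          by (subst nn_integral_eq_integral) (auto simp: l2_inner_def power2_eq_square sq_integrable_def)
        ultimately show ?thesis using bnd[of "r k"] by (simp add: ennreal_leI less_imp_le)
      qed
      then show "\<forall>\<^sub>F k in sequentially. (\<integral>\<^sup>+\<omega>. ennreal ((S n \<omega> - S (r k) \<omega>)\<^sup>2) \<partial>M) \<le> ennreal \<epsilon>"
        by (auto simp: eventually_sequentially)
    qed simp
    finally show ?thesis .
  qed
  have sqY: "sq_integrable M Y"
  proof -
    obtain N where N: "\<forall>i\<ge>N. \<forall>j\<ge>N. l2_inner M (\<lambda>\<omega>. S i \<omega> - S j \<omega>) (\<lambda>\<omega>. S i \<omega> - S j \<omega>) < 1"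
      using cauchy[of 1] by auto
    have "(\<integral>\<^sup>+\<omega>. ennreal ((S N \<omega> - Y \<omega>)\<^sup>2) \<partial>M) \<le> ennreal 1"
      by (rule fatou[of N]) (use N in auto)
    then have "integrable M (\<lambda>\<omega>. (S N \<omega> - Y \<omega>)\<^sup>2)"
      by (intro integrableI_bounded) (auto intro: le_less_trans[OF _ ennreal_one_less_top])
    then have "sq_integrable M (\<lambda>\<omega>. S N \<omega> - Y \<omega>)" by (simp add: sq_integrable_def)
    from sq_integrable_diff[OF sq[of N] this] show ?thesis by simp
  qed
  have "(\<lambda>n. l2_inner M (\<lambda>\<omega>. S n \<omega> - Y \<omega>) (\<lambda>\<omega>. S n \<omega> - Y \<omega>)) \<longlonglongrightarrow> 0"
  proof (rule LIMSEQ_I)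
    fix \<epsilon> :: real assume \<epsilon>: "\<epsilon> > 0"
    obtain N where N: "\<forall>i\<ge>N. \<forall>j\<ge>N. l2_inner M (\<lambda>\<omega>. S i \<omega> - S j \<omega>) (\<lambda>\<omega>. S i \<omega> - S j \<omega>) < \<epsilon> / 2"
      using cauchy[of "\<epsilon> / 2"] \<epsilon> by auto
    have "l2_inner M (\<lambda>\<omega>. S n \<omega> - Y \<omega>) (\<lambda>\<omega>. S n \<omega> - Y \<omega>) \<le> \<epsilon> / 2" if "n \<ge> N" for n
    proof -
      have "(\<integral>\<^sup>+\<omega>. ennreal ((S n \<omega> - Y \<omega>)\<^sup>2) \<partial>M) \<le> ennreal (\<epsilon> / 2)"
        by (rule fatou[of N]) (use N that in auto)
      moreover have "(\<integral>\<^sup>+\<omega>. ennreal ((S n \<omega> - Y \<omega>)\<^sup>2) \<partial>M) =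
            ennreal (l2_inner M (\<lambda>\<omega>. S n \<omega> - Y \<omega>) (\<lambda>\<omega>. S n \<omega> - Y \<omega>))"
        using sq_integrable_diff[OF sq[of n] sqY]
        by (subst nn_integral_eq_integral) (auto simp: l2_inner_def power2_eq_square sq_integrable_def)
      ultimately show ?thesis using \<epsilon> by (simp add: ennreal_le_iff)
    qed
    then show "\<exists>no. \<forall>n\<ge>no. norm (l2_inner M (\<lambda>\<omega>. S n \<omega> - Y \<omega>) (\<lambda>\<omega>. S n \<omega> - Y \<omega>) - 0) < \<epsilon>"
      using \<epsilon> by (intro exI[of _ N]) fastforce
  qed
  then have "ms_tendsto M S Y sequentially" using sq sqY by (simp add: ms_tendsto_iff)
  then show thesis by (rule that)
qed

text \<open>Loeve's criterion. If the covariance \<open>E[X\<^sub>s X\<^sub>t]\<close> has a joint limit \<open>L\<close>, then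
\<open>\<parallel>X\<^sub>s - X\<^sub>t\<parallel>\<^sup>2 = E[X\<^sub>s\<^sup>2] - 2 E[X\<^sub>s X\<^sub>t] + E[X\<^sub>t\<^sup>2]\<close> tends to \<open>L - 2 L + L = 0\<close>, and completeness
supplies the limit.\<close>

lemma loeve_criterion:
  fixes X :: "real \<Rightarrow> 'a \<Rightarrow> real"
  assumes sq: "\<And>t. sq_integrable M (X t)"
    and conv: "\<And>\<epsilon>. \<epsilon> > 0 \<Longrightarrow> \<exists>\<delta>>0. \<forall>s t. 0 < \<bar>s\<bar> \<and> \<bar>s\<bar> < \<delta> \<and> 0 < \<bar>t\<bar> \<and> \<bar>t\<bar> < \<delta> \<longrightarrow>
      \<bar>l2_inner M (X s) (X t) - L\<bar> < \<epsilon>"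
  obtains Y where "ms_tendsto M X Y (at 0)"
proof -
  let ?n = "\<lambda>s t. l2_inner M (\<lambda>\<omega>. X s \<omega> - X t \<omega>) (\<lambda>\<omega>. X s \<omega> - X t \<omega>)"
  have cauchy: "\<exists>\<delta>>0. \<forall>s t. 0 < \<bar>s\<bar> \<and> \<bar>s\<bar> < \<delta> \<and> 0 < \<bar>t\<bar> \<and> \<bar>t\<bar> < \<delta> \<longrightarrow> ?n s t < \<epsilon>"
    if \<epsilon>: "\<epsilon> > 0" for \<epsilon>
  proof -
    obtain \<delta> where \<delta>: "\<delta> > 0" "\<And>s t. 0 < \<bar>s\<bar> \<and> \<bar>s\<bar> < \<delta> \<and> 0 < \<bar>t\<bar> \<and> \<bar>t\<bar> < \<delta> \<Longrightarrow>
      \<bar>l2_inner M (X s) (X t) - L\<bar> < \<epsilon> / 4"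
      using conv[of "\<epsilon> / 4"] \<epsilon> by auto
    have "?n s t < \<epsilon>" if st: "0 < \<bar>s\<bar> \<and> \<bar>s\<bar> < \<delta> \<and> 0 < \<bar>t\<bar> \<and> \<bar>t\<bar> < \<delta>" for s t
    proof -
      have "?n s t = l2_inner M (X s) (X s) - 2 * l2_inner M (X s) (X t) + l2_inner M (X t) (X t)"
        by (simp add: l2_inner_bilinear sq l2_inner_commute[of M "X t" "X s"])
      moreover have "\<bar>l2_inner M (X s) (X t) - L\<bar> < \<epsilon> / 4"
          "\<bar>l2_inner M (X s) (X s) - L\<bar> < \<epsilon> / 4" "\<bar>l2_inner M (X t) (X t) - L\<bar> < \<epsilon> / 4"
        using \<delta>(2) st by blast+
      ultimately show ?thesis by linarith
    qed
    then show ?thesis using \<delta>(1) by blast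
  qed
  define r where "r n = inverse (real (Suc n))" for n
  have r0: "0 < \<bar>r n\<bar>" for n by (simp add: r_def)
  have rlim: "r \<longlonglongrightarrow> 0" unfolding r_def by (rule LIMSEQ_inverse_real_of_nat)
  obtain Y where Y: "ms_tendsto M (\<lambda>n. X (r n)) Y sequentially"
  proof (rule l2_complete)
    fix \<epsilon> :: real assume "\<epsilon> > 0"
    from cauchy[OF this] obtain \<delta> where \<delta>: "\<delta> > 0"
      "\<And>s t. 0 < \<bar>s\<bar> \<and> \<bar>s\<bar> < \<delta> \<and> 0 < \<bar>t\<bar> \<and> \<bar>t\<bar> < \<delta> \<Longrightarrow> ?n s t < \<epsilon>" by blast
    obtain N where "\<forall>n\<ge>N. \<bar>r n\<bar> < \<delta>" using LIMSEQ_D[OF rlim \<delta>(1)] by auto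
    then show "\<exists>N. \<forall>i\<ge>N. \<forall>j\<ge>N. ?n (r i) (r j) < \<epsilon>" using \<delta>(2) r0 by blast
  qed (simp_all add: sq)
  have sqY: "sq_integrable M Y" using Y by (rule ms_tendsto_sq_integrable)
  let ?m = "\<lambda>t. l2_inner M (\<lambda>\<omega>. X t \<omega> - Y \<omega>) (\<lambda>\<omega>. X t \<omega> - Y \<omega>)"
  have "(?m \<longlongrightarrow> 0) (at 0)"
  proof (rule LIM_I)
    fix \<epsilon> :: real assume \<epsilon>: "\<epsilon> > 0"
    then obtain \<delta> where \<delta>: "\<delta> > 0"
      "\<And>s t. 0 < \<bar>s\<bar> \<and> \<bar>s\<bar> < \<delta> \<and> 0 < \<bar>t\<bar> \<and> \<bar>t\<bar> < \<delta> \<Longrightarrow> ?n s t < \<epsilon> / 4"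
      using cauchy[of "\<epsilon> / 4"] by auto
    have "\<forall>\<^sub>F n in sequentially. ?m (r n) < \<epsilon> / 4"
      using Y \<epsilon> by (intro order_tendstoD[where y = 0]) (auto simp: ms_tendsto_iff)
    moreover have "\<forall>\<^sub>F n in sequentially. \<bar>r n\<bar> < \<delta>"
      using tendsto_rabs[OF rlim] \<delta>(1) by (intro order_tendstoD[where y = 0]) auto
    ultimately have "\<forall>\<^sub>F n in sequentially. ?m (r n) < \<epsilon> / 4 \<and> \<bar>r n\<bar> < \<delta>"
      by (rule eventually_conj)
    then obtain n where n: "?m (r n) < \<epsilon> / 4" "\<bar>r n\<bar> < \<delta>"
      using eventually_happens trivial_limit_sequentially by blast
    have "?m t < \<epsilon>" if "0 < \<bar>t\<bar>" "\<bar>t\<bar> < \<delta>" for t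
      using l2_inner_diff_triangle[OF sq[of t] sq[of "r n"] sqY] n \<delta>(2)[of t "r n"] r0[of n] that
      by linarith
    then show "\<exists>s>0. \<forall>x. x \<noteq> 0 \<and> norm (x - 0) < s \<longrightarrow> norm (?m x - 0) < \<epsilon>"
      using \<delta>(1) by (intro exI[of _ \<delta>]) auto
  qed
  then have "ms_tendsto M X Y (at 0)" using sq sqY by (simp add: ms_tendsto_iff)
  then show thesis by (rule that)
qed

end

section \<open>Existence of mean-square derivatives\<close>

lemma cont_differentiable_continuous: "cont_differentiable n f \<Longrightarrow> continuous_on UNIV f"
  by (cases n) (auto intro!: differentiable_imp_continuous_on simp: differentiable_on_def)

lemma has_real_derivative_along_line:
  fixes f :: "'b::real_normed_vector \<Rightarrow> real"
  assumes "f differentiable (at (p + t *\<^sub>R e))"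
  shows "((\<lambda>t. f (p + t *\<^sub>R e)) has_real_derivative frechet_derivative f (at (p + t *\<^sub>R e)) e) (at t)"
proof -
  let ?D = "frechet_derivative f (at (p + t *\<^sub>R e))"
  have D: "(f has_derivative ?D) (at (p + t *\<^sub>R e))"
    using assms by (simp add: frechet_derivative_works)
  have "((\<lambda>t. p + t *\<^sub>R e) has_derivative (\<lambda>r. r *\<^sub>R e)) (at t)"
    by (auto intro!: derivative_eq_intros)
  from has_derivative_compose[OF this D]
  have "((\<lambda>t. f (p + t *\<^sub>R e)) has_derivative (\<lambda>r. ?D (r *\<^sub>R e))) (at t)" .
  then show ?thesis
    using linear_scale[OF has_derivative_linear[OF D]]
    by (simp add: has_field_derivative_def mult.commute[of _ "?D e"])
qed

text \<open>A mean value theorem that covers both signs of the increment, since mean-square derivatives are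
two-sided limits.\<close>
lemma mvt_from_zero:
  fixes g :: "real \<Rightarrow> real"
  assumes "\<And>t. (g has_real_derivative g' t) (at t)"
  obtains \<tau> where "\<bar>\<tau>\<bar> \<le> \<bar>t\<bar>" "g t - g 0 = t * g' \<tau>"
proof (cases t "0 :: real" rule: linorder_cases)
  case less
  then obtain z where "z > t" "z < 0" "g 0 - g t = (0 - t) * g' z"
    using MVT2[of t 0 g g'] assms by blast
  then show thesis using less by (intro that[of z]) (auto simp: algebra_simps)
next
  case equal
  then show thesis by (intro that[of 0]) auto
next
  case greater
  then obtain z where "z > 0" "z < t" "g t - g 0 = (t - 0) * g' z"
    using MVT2[of 0 t g g'] assms by blast
  then show thesis using greater by (intro that[of z]) auto
qed

text \<open>Directional derivatives in one of the two arguments of a kernel. They are derivatives of the joint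
function, so that the smoothness of the kernel is inherited in both arguments at once.\<close>

definition partial_snd :: "'b \<Rightarrow> ('b::real_normed_vector \<times> 'b \<Rightarrow> real) \<Rightarrow> 'b \<times> 'b \<Rightarrow> real" where
  "partial_snd e K p = frechet_derivative K (at p) (0, e)"

definition partial_fst :: "'b \<Rightarrow> ('b::real_normed_vector \<times> 'b \<Rightarrow> real) \<Rightarrow> 'b \<times> 'b \<Rightarrow> real" where
  "partial_fst e K p = frechet_derivative K (at p) (e, 0)"

lemma cont_differentiable_partial:
  assumes "cont_differentiable (Suc n) K"
  shows "cont_differentiable n (partial_fst e K)" "cont_differentiable n (partial_snd e K)"
  using assms by (auto simp: partial_fst_def[abs_def] partial_snd_def[abs_def])

lemma has_real_derivative_partial_snd:
  assumes "cont_differentiable (Suc n) K"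
  shows "((\<lambda>t. K (x, y + t *\<^sub>R e)) has_real_derivative partial_snd e K (x, y + t *\<^sub>R e)) (at t)"
  using has_real_derivative_along_line[of K "(x, y)" t "(0, e)"] assms
  by (simp add: partial_snd_def)

lemma has_real_derivative_partial_fst:
  assumes "cont_differentiable (Suc n) K"
  shows "((\<lambda>t. K (x + t *\<^sub>R e, y)) has_real_derivative partial_fst e K (x + t *\<^sub>R e, y)) (at t)"
  using has_real_derivative_along_line[of K "(x, y)" t "(e, 0)"] assms
  by (simp add: partial_fst_def)

text \<open>The mean value theorem is applied in the second argument to the increment of \<open>K\<close> in the first
argument, and then once more in the first argument.\<close>
lemma mixed_difference:
  fixes K :: "'b::real_normed_vector \<times> 'b \<Rightarrow> real"
  assumes K: "cont_differentiable (Suc (Suc n)) K"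
  obtains \<sigma> \<tau> where "\<bar>\<sigma>\<bar> \<le> \<bar>s\<bar>" "\<bar>\<tau>\<bar> \<le> \<bar>t\<bar>"
    "K (x + s *\<^sub>R e, x + t *\<^sub>R e) - K (x, x + t *\<^sub>R e) - K (x + s *\<^sub>R e, x) + K (x, x) =
     s * t * partial_fst e (partial_snd e K) (x + \<sigma> *\<^sub>R e, x + \<tau> *\<^sub>R e)"
proof -
  let ?K2 = "partial_snd e K" and ?K12 = "partial_fst e (partial_snd e K)"
  have "((\<lambda>t. K (x + s *\<^sub>R e, x + t *\<^sub>R e) - K (x, x + t *\<^sub>R e)) has_real_derivative
      ?K2 (x + s *\<^sub>R e, x + t *\<^sub>R e) - ?K2 (x, x + t *\<^sub>R e)) (at t)" for t
    by (intro DERIV_diff has_real_derivative_partial_snd[OF K])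
  then obtain \<tau> where \<tau>: "\<bar>\<tau>\<bar> \<le> \<bar>t\<bar>"
    "K (x + s *\<^sub>R e, x + t *\<^sub>R e) - K (x, x + t *\<^sub>R e) - (K (x + s *\<^sub>R e, x + 0 *\<^sub>R e) - K (x, x + 0 *\<^sub>R e)) =
     t * (?K2 (x + s *\<^sub>R e, x + \<tau> *\<^sub>R e) - ?K2 (x, x + \<tau> *\<^sub>R e))"
    by (rule mvt_from_zero)
  have "((\<lambda>s. ?K2 (x + s *\<^sub>R e, x + \<tau> *\<^sub>R e)) has_real_derivative
      ?K12 (x + s *\<^sub>R e, x + \<tau> *\<^sub>R e)) (at s)" for s
    by (rule has_real_derivative_partial_fst[OF cont_differentiable_partial(2)[OF K]])
  then obtain \<sigma> where \<sigma>: "\<bar>\<sigma>\<bar> \<le> \<bar>s\<bar>"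
    "?K2 (x + s *\<^sub>R e, x + \<tau> *\<^sub>R e) - ?K2 (x + 0 *\<^sub>R e, x + \<tau> *\<^sub>R e) =
     s * ?K12 (x + \<sigma> *\<^sub>R e, x + \<tau> *\<^sub>R e)"
    by (rule mvt_from_zero)
  show thesis
    by (rule that[OF \<sigma>(1) \<tau>(1)]) (use \<sigma>(2) \<tau>(2) in \<open>simp add: algebra_simps\<close>)
qed

lemma has_ms_derivative_unique:
  "has_ms_derivative M F e x Y \<Longrightarrow> has_ms_derivative M F e x Z \<Longrightarrow> AE \<omega> in M. Y \<omega> = Z \<omega>"
  unfolding has_ms_derivative_def by (rule ms_tendsto_unique) auto

lemma has_ms_derivative_ms_deriv:
  "has_ms_derivative M F e x Y \<Longrightarrow> has_ms_derivative M F e x (ms_deriv M e F x)"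
  unfolding ms_deriv_def by (rule someI[where P = "has_ms_derivative M F e x"])

lemma has_ms_derivative_cong_AE:
  assumes F: "has_ms_derivative M F e x Y" and eq: "\<And>x. AE \<omega> in M. F x \<omega> = G x \<omega>"
    and G: "\<And>x. sq_integrable M (G x)"
  shows "has_ms_derivative M G e x Y"
  unfolding has_ms_derivative_def
proof (rule ms_tendsto_cong_AE)
  show "ms_tendsto M (\<lambda>t \<omega>. (F (x + t *\<^sub>R e) \<omega> - F x \<omega>) / t) Y (at 0)"
    using F by (simp add: has_ms_derivative_def)
  show "AE \<omega> in M. (F (x + t *\<^sub>R e) \<omega> - F x \<omega>) / t = (G (x + t *\<^sub>R e) \<omega> - G x \<omega>) / t" for t
    using eq[of "x + t *\<^sub>R e"] eq[of x] by eventually_elim simp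
  show "sq_integrable M (\<lambda>\<omega>. (G (x + t *\<^sub>R e) \<omega> - G x \<omega>) / t)" for t
    by (simp add: G)
qed

lemma has_ms_derivative_sq_integrable: "has_ms_derivative M F e x Y \<Longrightarrow> sq_integrable M Y"
  unfolding has_ms_derivative_def by (rule ms_tendsto_sq_integrable)

text \<open>Pairing with a fixed random variable turns a mean-square derivative into an ordinary one.\<close>
lemma has_ms_derivative_inner:
  assumes F: "\<And>x. sq_integrable M (F x)" and Y: "has_ms_derivative M F e x Y"
    and Z: "sq_integrable M Z"
  shows "((\<lambda>t. l2_inner M (F (x + t *\<^sub>R e)) Z) has_real_derivative l2_inner M Y Z) (at 0)"
proof -
  have "((\<lambda>t. l2_inner M (\<lambda>\<omega>. (F (x + t *\<^sub>R e) \<omega> - F x \<omega>) / t) Z) \<longlongrightarrow> l2_inner M Y Z) (at 0)"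
    using Y Z unfolding has_ms_derivative_def by (rule ms_tendsto_inner_left)
  then show ?thesis
    by (simp add: DERIV_def l2_inner_bilinear F Z)
qed

lemma has_ms_derivative_inner_eq:
  assumes F: "\<And>x. sq_integrable M (F x)" and Y: "has_ms_derivative M F e x Y"
    and Z: "sq_integrable M Z"
    and D: "((\<lambda>t. l2_inner M (F (x + t *\<^sub>R e)) Z) has_real_derivative D) (at 0)"
  shows "l2_inner M Y Z = D"
  using has_ms_derivative_inner[OF F Y Z] D by (rule DERIV_unique)

context prob_space
begin

text \<open>The covariance of two difference quotients is a mixed second difference quotient of the kernel; by
the two-fold mean value theorem it is a value of the mixed second derivative near the diagonal, which is continuous. Loeve's
criterion then applies.\<close>
lemma ms_derivative_exists:
  fixes F :: "'b::real_normed_vector \<Rightarrow> 'a \<Rightarrow> real"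
  assumes F: "\<And>x. sq_integrable M (F x)"
    and K: "cont_differentiable (Suc (Suc n)) (\<lambda>(x, y). l2_inner M (F x) (F y))"
  obtains Y where "has_ms_derivative M F e x Y"
proof -
  let ?K = "\<lambda>(x, y). l2_inner M (F x) (F y)"
  define K12 where "K12 = partial_fst e (partial_snd e ?K)"
  let ?D = "\<lambda>t \<omega>. (F (x + t *\<^sub>R e) \<omega> - F x \<omega>) / t"
  have "continuous_on UNIV K12"
    unfolding K12_def
    by (rule cont_differentiable_continuous[OF cont_differentiable_partial(1)[OF cont_differentiable_partial(2)[OF K]]])
  then have "continuous_on UNIV (\<lambda>q. K12 (x + fst q *\<^sub>R e, x + snd q *\<^sub>R e))"
    by (rule continuous_on_compose2) (auto intro!: continuous_intros)
  then have cont: "isCont (\<lambda>q. K12 (x + fst q *\<^sub>R e, x + snd q *\<^sub>R e)) (0, 0)"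
    by (simp add: continuous_on_eq_continuous_at)
  obtain Y where "ms_tendsto M ?D Y (at 0)"
  proof (rule loeve_criterion)
    show "sq_integrable M (?D t)" for t by (simp add: F)
  next
    fix \<epsilon> :: real assume "\<epsilon> > 0"
    then obtain \<delta> where \<delta>: "\<delta> > 0"
      "\<And>q. dist q (0, 0) < \<delta> \<Longrightarrow> dist (K12 (x + fst q *\<^sub>R e, x + snd q *\<^sub>R e)) (K12 (x, x)) < \<epsilon>"
      using cont unfolding continuous_at_eps_delta by fastforce
    have "\<bar>l2_inner M (?D s) (?D t) - K12 (x, x)\<bar> < \<epsilon>"
      if st: "0 < \<bar>s\<bar>" "\<bar>s\<bar> < \<delta> / 2" "0 < \<bar>t\<bar>" "\<bar>t\<bar> < \<delta> / 2" for s t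
    proof -
      obtain \<sigma> \<tau> where *: "\<bar>\<sigma>\<bar> \<le> \<bar>s\<bar>" "\<bar>\<tau>\<bar> \<le> \<bar>t\<bar>"
        "?K (x + s *\<^sub>R e, x + t *\<^sub>R e) - ?K (x, x + t *\<^sub>R e) - ?K (x + s *\<^sub>R e, x) + ?K (x, x) =
          s * t * K12 (x + \<sigma> *\<^sub>R e, x + \<tau> *\<^sub>R e)"
        unfolding K12_def by (rule mixed_difference[OF K])
      have "l2_inner M (?D s) (?D t) =
          (?K (x + s *\<^sub>R e, x + t *\<^sub>R e) - ?K (x, x + t *\<^sub>R e) - ?K (x + s *\<^sub>R e, x) + ?K (x, x)) / (s * t)"
        by (simp add: l2_inner_bilinear F diff_divide_distrib add_divide_distrib mult.commute)
      also have "\<dots> = K12 (x + \<sigma> *\<^sub>R e, x + \<tau> *\<^sub>R e)"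
        unfolding *(3) using st by simp
      finally have eq: "l2_inner M (?D s) (?D t) = K12 (x + \<sigma> *\<^sub>R e, x + \<tau> *\<^sub>R e)" .
      have "dist (\<sigma>, \<tau>) (0, 0) \<le> \<bar>\<sigma>\<bar> + \<bar>\<tau>\<bar>"
        using norm_Pair_le[of \<sigma> \<tau>] by (simp add: dist_norm)
      then have "dist (\<sigma>, \<tau>) (0, 0) < \<delta>" using * st by linarith
      from \<delta>(2)[OF this] show ?thesis by (simp add: eq dist_real_def)
    qed
    then show "\<exists>\<delta>>0. \<forall>s t. 0 < \<bar>s\<bar> \<and> \<bar>s\<bar> < \<delta> \<and> 0 < \<bar>t\<bar> \<and> \<bar>t\<bar> < \<delta> \<longrightarrow>
        \<bar>l2_inner M (?D s) (?D t) - K12 (x, x)\<bar> < \<epsilon>"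
      using \<delta>(1) by (intro exI[of _ "\<delta> / 2"]) auto
  qed
  then show thesis by (intro that) (simp add: has_ms_derivative_def)
qed

lemma ms_deriv_works:
  fixes F :: "'b::real_normed_vector \<Rightarrow> 'a \<Rightarrow> real"
  assumes "\<And>x. sq_integrable M (F x)"
    and "cont_differentiable (Suc (Suc n)) (\<lambda>(x, y). l2_inner M (F x) (F y))"
  shows "has_ms_derivative M F e x (ms_deriv M e F x)"
  by (rule ms_derivative_exists[OF assms, of e x]) (rule has_ms_derivative_ms_deriv)

text \<open>A mean-square derivative consumes one derivative of the kernel in each argument. So a field with a
\<open>C\<^sup>4\<close> kernel can be differentiated twice.\<close>
lemma cont_differentiable_covariance_ms_deriv:
  fixes F :: "'b::real_normed_vector \<Rightarrow> 'a \<Rightarrow> real"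
  assumes F: "\<And>x. sq_integrable M (F x)"
    and K: "cont_differentiable (Suc (Suc n)) (\<lambda>(x, y). l2_inner M (F x) (F y))"
  shows "cont_differentiable n (\<lambda>(x, y). l2_inner M (ms_deriv M e F x) (ms_deriv M e F y))"
proof -
  let ?K = "\<lambda>(x, y). l2_inner M (F x) (F y)" and ?G = "ms_deriv M e F"
  have der: "has_ms_derivative M F e x (?G x)" for x by (rule ms_deriv_works[OF F K])
  have G: "sq_integrable M (?G x)" for x using der by (rule has_ms_derivative_sq_integrable)
  have 1: "l2_inner M (F x) (?G y) = partial_snd e ?K (x, y)" for x y
  proof -
    have "((\<lambda>t. l2_inner M (F (y + t *\<^sub>R e)) (F x)) has_real_derivative partial_snd e ?K (x, y)) (at 0)"
      using has_real_derivative_partial_snd[OF K, where e = e and x = x and y = y and t = 0] by (simp add: l2_inner_commute[of M _ "F x"])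
    from has_ms_derivative_inner_eq[OF F der F this] show ?thesis by (simp add: l2_inner_commute)
  qed
  have "l2_inner M (?G x) (?G y) = partial_fst e (partial_snd e ?K) (x, y)" for x y
  proof (rule has_ms_derivative_inner_eq[OF F der G])
    show "((\<lambda>t. l2_inner M (F (x + t *\<^sub>R e)) (?G y)) has_real_derivative
        partial_fst e (partial_snd e ?K) (x, y)) (at 0)"
      unfolding 1
      using has_real_derivative_partial_fst[OF cont_differentiable_partial(2)[OF K], where e = e and x = x and y = y and t = 0] by simp
  qed
  then have "(\<lambda>(x, y). l2_inner M (?G x) (?G y)) = partial_fst e (partial_snd e ?K)" by auto
  then show ?thesis
    using cont_differentiable_partial(1)[OF cont_differentiable_partial(2)[OF K]] by simp
qed

end

section \<open>Closed linear spans of Gaussian fields\<close>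

definition l2_span :: "('x \<Rightarrow> 'w \<Rightarrow> real) \<Rightarrow> ('w \<Rightarrow> real) set" where
  "l2_span F = {X. \<exists>S c. finite S \<and> X = (\<lambda>\<omega>. \<Sum>x\<in>S. c x * F x \<omega>)}"

text \<open>Approximation is required up to every \<open>\<epsilon>\<close> rather than along a sequence, because this form is
stable under further limits without a diagonal argument.\<close>
definition l2_closed_span :: "'w measure \<Rightarrow> ('x \<Rightarrow> 'w \<Rightarrow> real) \<Rightarrow> ('w \<Rightarrow> real) set" where
  "l2_closed_span M F = {X. sq_integrable M X \<and>
     (\<forall>\<epsilon>>0. \<exists>Y\<in>l2_span F. l2_inner M (\<lambda>\<omega>. X \<omega> - Y \<omega>) (\<lambda>\<omega>. X \<omega> - Y \<omega>) < \<epsilon>)}"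

lemma l2_span_base: "F x \<in> l2_span F"
  unfolding l2_span_def by (rule CollectI, rule exI[of _ "{x}"], rule exI[of _ "\<lambda>_. 1"]) auto

lemma l2_span_scale: "X \<in> l2_span F \<Longrightarrow> (\<lambda>\<omega>. a * X \<omega>) \<in> l2_span F"
proof -
  assume "X \<in> l2_span F"
  then obtain S c where "finite S" "X = (\<lambda>\<omega>. \<Sum>x\<in>S. c x * F x \<omega>)" by (auto simp: l2_span_def)
  then show ?thesis
    unfolding l2_span_def
    by (intro CollectI exI[of _ S] exI[of _ "\<lambda>x. a * c x"]) (auto simp: sum_distrib_left mult.assoc)
qed

lemma l2_span_add:
  assumes "X \<in> l2_span F" "Y \<in> l2_span F"
  shows "(\<lambda>\<omega>. X \<omega> + Y \<omega>) \<in> l2_span F"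
proof -
  obtain S c where S: "finite S" "X = (\<lambda>\<omega>. \<Sum>x\<in>S. c x * F x \<omega>)"
    using assms(1) by (auto simp: l2_span_def)
  obtain T d where T: "finite T" "Y = (\<lambda>\<omega>. \<Sum>x\<in>T. d x * F x \<omega>)"
    using assms(2) by (auto simp: l2_span_def)
  let ?c = "\<lambda>x. if x \<in> S then c x else 0" and ?d = "\<lambda>x. if x \<in> T then d x else 0"
  have "X \<omega> + Y \<omega> = (\<Sum>x\<in>S \<union> T. (?c x + ?d x) * F x \<omega>)" for \<omega>
  proof -
    have "X \<omega> = (\<Sum>x\<in>S \<union> T. ?c x * F x \<omega>)"
      unfolding S(2) by (rule sum.mono_neutral_cong_left) (use S T in auto)
    moreover have "Y \<omega> = (\<Sum>x\<in>S \<union> T. ?d x * F x \<omega>)"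
      unfolding T(2) by (rule sum.mono_neutral_cong_left) (use S T in auto)
    ultimately show ?thesis by (simp only: distrib_right sum.distrib)
  qed
  then show ?thesis
    unfolding l2_span_def using S(1) T(1)
    by (intro CollectI exI[of _ "S \<union> T"] exI[of _ "\<lambda>x. ?c x + ?d x"]) auto
qed

lemma l2_span_sq_integrable:
  assumes "\<And>x. sq_integrable M (F x)" "X \<in> l2_span F"
  shows "sq_integrable M X"
  using assms by (auto simp: l2_span_def)

lemma l2_span_diff:
  assumes "X \<in> l2_span F" "Y \<in> l2_span F"
  shows "(\<lambda>\<omega>. X \<omega> - Y \<omega>) \<in> l2_span F"
  using l2_span_add[OF assms(1) l2_span_scale[OF assms(2), of "-1"]] by simp

lemma l2_span_zero: "(\<lambda>_. 0) \<in> l2_span F"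
  unfolding l2_span_def by (intro CollectI exI[of _ "{}"]) auto

lemma l2_span_sum:
  "(\<And>i. i \<in> I \<Longrightarrow> X i \<in> l2_span F) \<Longrightarrow> (\<lambda>\<omega>. \<Sum>i\<in>I. X i \<omega>) \<in> l2_span F"
  by (induction I rule: infinite_finite_induct) (auto intro: l2_span_zero l2_span_add)

text \<open>Linear relations between random variables are read off from their covariances: a combination that is
orthogonal to every generator is orthogonal to itself.\<close>
lemma l2_span_orthogonal_AE_zero:
  assumes F: "\<And>x. sq_integrable M (F x)" and Y: "Y \<in> l2_span F"
    and orth: "\<And>x. l2_inner M Y (F x) = 0"
  shows "AE \<omega> in M. Y \<omega> = 0"
proof -
  have sqY: "sq_integrable M Y" by (rule l2_span_sq_integrable[OF F Y])
  obtain S c where S: "finite S" "Y = (\<lambda>\<omega>. \<Sum>x\<in>S. c x * F x \<omega>)"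
    using Y by (auto simp: l2_span_def)
  have "l2_inner M Y Y = l2_inner M Y (\<lambda>\<omega>. \<Sum>x\<in>S. c x * F x \<omega>)" by (simp only: S(2))
  also have "\<dots> = (\<Sum>x\<in>S. c x * l2_inner M Y (F x))"
    by (subst l2_inner_sum_right) (simp_all add: F sqY l2_inner_scale_right)
  finally have "l2_inner M Y Y = 0" by (simp add: orth)
  then show ?thesis by (rule l2_inner_self_eq_0_AE[OF sqY])
qed

lemma l2_closed_span_sq_integrable: "X \<in> l2_closed_span M F \<Longrightarrow> sq_integrable M X"
  by (simp add: l2_closed_span_def)

lemma l2_closed_span_base:
  assumes "\<And>x. sq_integrable M (F x)"
  shows "F x \<in> l2_closed_span M F"
  unfolding l2_closed_span_def using assms l2_span_base[of F x]
  by (auto intro!: bexI[of _ "F x"] simp: l2_inner_def)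

lemma l2_closed_span_sequence:
  assumes F: "\<And>x. sq_integrable M (F x)" and X: "X \<in> l2_closed_span M F"
  obtains Y where "\<And>n. Y n \<in> l2_span F" "ms_tendsto M Y X sequentially"
proof -
  have "\<forall>n. \<exists>Y\<in>l2_span F. l2_inner M (\<lambda>\<omega>. X \<omega> - Y \<omega>) (\<lambda>\<omega>. X \<omega> - Y \<omega>) < inverse (real (Suc n))"
    using X by (auto simp: l2_closed_span_def)
  then obtain Y where Y: "\<And>n. Y n \<in> l2_span F"
    "\<And>n. l2_inner M (\<lambda>\<omega>. X \<omega> - Y n \<omega>) (\<lambda>\<omega>. X \<omega> - Y n \<omega>) < inverse (real (Suc n))"
    by metis
  have swap: "l2_inner M (\<lambda>\<omega>. Y n \<omega> - X \<omega>) (\<lambda>\<omega>. Y n \<omega> - X \<omega>) =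
      l2_inner M (\<lambda>\<omega>. X \<omega> - Y n \<omega>) (\<lambda>\<omega>. X \<omega> - Y n \<omega>)" for n
    unfolding l2_inner_def by (simp add: algebra_simps)
  have "(\<lambda>n. l2_inner M (\<lambda>\<omega>. Y n \<omega> - X \<omega>) (\<lambda>\<omega>. Y n \<omega> - X \<omega>)) \<longlonglongrightarrow> 0"
  proof (rule tendsto_sandwich[OF _ _ tendsto_const LIMSEQ_inverse_real_of_nat])
    show "\<forall>\<^sub>F n in sequentially. l2_inner M (\<lambda>\<omega>. Y n \<omega> - X \<omega>) (\<lambda>\<omega>. Y n \<omega> - X \<omega>) \<le> inverse (real (Suc n))"
      unfolding swap using Y(2) by (simp add: less_imp_le)
  qed simp
  then have "ms_tendsto M Y X sequentially"
    using X l2_span_sq_integrable[OF F Y(1)] by (simp add: ms_tendsto_iff l2_closed_span_def)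
  with Y(1) show thesis by (rule that)
qed

lemma l2_closed_spanI:
  assumes F: "\<And>x. sq_integrable M (F x)" and lim: "ms_tendsto M X Y l" and l: "l \<noteq> bot"
    and X: "\<And>t. X t \<in> l2_closed_span M F"
  shows "Y \<in> l2_closed_span M F"
  unfolding l2_closed_span_def
proof (intro CollectI conjI allI impI)
  show sqY: "sq_integrable M Y" using lim by (rule ms_tendsto_sq_integrable)
  fix \<epsilon> :: real assume \<epsilon>: "\<epsilon> > 0"
  have "\<forall>\<^sub>F t in l. l2_inner M (\<lambda>\<omega>. X t \<omega> - Y \<omega>) (\<lambda>\<omega>. X t \<omega> - Y \<omega>) < \<epsilon> / 4"
    using lim \<epsilon> by (intro order_tendstoD[where y = 0]) (auto simp: ms_tendsto_iff)
  then obtain t where t: "l2_inner M (\<lambda>\<omega>. X t \<omega> - Y \<omega>) (\<lambda>\<omega>. X t \<omega> - Y \<omega>) < \<epsilon> / 4"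
    using eventually_happens l by blast
  obtain W where W: "W \<in> l2_span F" "l2_inner M (\<lambda>\<omega>. X t \<omega> - W \<omega>) (\<lambda>\<omega>. X t \<omega> - W \<omega>) < \<epsilon> / 4"
    using X[of t] \<epsilon> by (auto simp: l2_closed_span_def dest!: spec[of _ "\<epsilon> / 4"])
  have swap: "l2_inner M (\<lambda>\<omega>. Y \<omega> - X t \<omega>) (\<lambda>\<omega>. Y \<omega> - X t \<omega>) =
      l2_inner M (\<lambda>\<omega>. X t \<omega> - Y \<omega>) (\<lambda>\<omega>. X t \<omega> - Y \<omega>)"
    unfolding l2_inner_def by (simp add: algebra_simps)
  have "l2_inner M (\<lambda>\<omega>. Y \<omega> - W \<omega>) (\<lambda>\<omega>. Y \<omega> - W \<omega>) < \<epsilon>"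
    using l2_inner_diff_triangle[OF sqY l2_closed_span_sq_integrable[OF X[of t]]
        l2_span_sq_integrable[OF F W(1)]] t W(2) unfolding swap by linarith
  then show "\<exists>W\<in>l2_span F. l2_inner M (\<lambda>\<omega>. Y \<omega> - W \<omega>) (\<lambda>\<omega>. Y \<omega> - W \<omega>) < \<epsilon>"
    using W(1) by blast
qed

lemma l2_span_subset_closed_span:
  assumes "\<And>x. sq_integrable M (F x)" "X \<in> l2_span F"
  shows "X \<in> l2_closed_span M F"
  unfolding l2_closed_span_def using assms l2_span_sq_integrable[OF assms]
  by (auto intro!: bexI[of _ X] simp: l2_inner_def)

lemma l2_closed_span_scale:
  assumes F: "\<And>x. sq_integrable M (F x)" and X: "X \<in> l2_closed_span M F"
  shows "(\<lambda>\<omega>. a * X \<omega>) \<in> l2_closed_span M F"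
proof -
  obtain Y where Y: "\<And>n. Y n \<in> l2_span F" "ms_tendsto M Y X sequentially"
    using l2_closed_span_sequence[OF F X] by metis
  show ?thesis
    by (rule l2_closed_spanI[OF F ms_tendsto_scale[OF Y(2)]])
      (auto intro!: l2_span_subset_closed_span F l2_span_scale Y)
qed

lemma l2_closed_span_add:
  assumes F: "\<And>x. sq_integrable M (F x)" and X: "X \<in> l2_closed_span M F" and X': "X' \<in> l2_closed_span M F"
  shows "(\<lambda>\<omega>. X \<omega> + X' \<omega>) \<in> l2_closed_span M F"
proof -
  obtain Y where Y: "\<And>n. Y n \<in> l2_span F" "ms_tendsto M Y X sequentially"
    using l2_closed_span_sequence[OF F X] by metis
  obtain Y' where Y': "\<And>n. Y' n \<in> l2_span F" "ms_tendsto M Y' X' sequentially"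
    using l2_closed_span_sequence[OF F X'] by metis
  show ?thesis
    by (rule l2_closed_spanI[OF F ms_tendsto_add[OF Y(2) Y'(2)]])
      (auto intro!: l2_span_subset_closed_span F l2_span_add Y Y')
qed

lemma l2_closed_span_diff:
  assumes F: "\<And>x. sq_integrable M (F x)" and X: "X \<in> l2_closed_span M F" and X': "X' \<in> l2_closed_span M F"
  shows "(\<lambda>\<omega>. X \<omega> - X' \<omega>) \<in> l2_closed_span M F"
  using l2_closed_span_add[OF F X l2_closed_span_scale[OF F X', of "-1"]] by simp

lemma l2_closed_span_cong_AE:
  assumes F: "\<And>x. sq_integrable M (F x)" and X: "X \<in> l2_closed_span M F"
    and eq: "AE \<omega> in M. X \<omega> = Y \<omega>" and Y: "Y \<in> borel_measurable M"
  shows "Y \<in> l2_closed_span M F"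
proof (rule l2_closed_spanI[OF F _ trivial_limit_sequentially])
  have sqX: "sq_integrable M X" using X by (rule l2_closed_span_sq_integrable)
  have sqY: "sq_integrable M Y" by (rule sq_integrable_cong_AE[OF sqX eq Y])
  have "l2_inner M (\<lambda>\<omega>. X \<omega> - Y \<omega>) (\<lambda>\<omega>. X \<omega> - Y \<omega>) = l2_inner M (\<lambda>_. 0) (\<lambda>_. 0)"
    by (rule l2_inner_cong_AE) (use eq sqX sqY in auto)
  then show "ms_tendsto M (\<lambda>_. X) Y sequentially"
    using sqX sqY by (simp add: ms_tendsto_iff l2_inner_def)
qed (rule X)

text \<open>Mean-square derivatives are limits of finite linear combinations, so they stay in the closed span.\<close>
lemma has_ms_derivative_closed_span:
  assumes F: "\<And>x. sq_integrable M (F x)" and G: "\<And>x. G x \<in> l2_closed_span M F"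
    and Y: "has_ms_derivative M G e x Y"
  shows "Y \<in> l2_closed_span M F"
proof (rule l2_closed_spanI[OF F])
  show "ms_tendsto M (\<lambda>t \<omega>. (G (x + t *\<^sub>R e) \<omega> - G x \<omega>) / t) Y (at 0)"
    using Y by (simp add: has_ms_derivative_def)
  show "(\<lambda>\<omega>. (G (x + t *\<^sub>R e) \<omega> - G x \<omega>) / t) \<in> l2_closed_span M F" for t
    using l2_closed_span_scale[OF F l2_closed_span_diff[OF F G G], of "inverse t" "x + t *\<^sub>R e" x]
    by (simp add: field_simps)
qed simp

context prob_space
begin

lemma gaussian_rv_sq_integrable:
  assumes "gaussian_rv M X"
  shows "sq_integrable M X"
proof -
  have X [measurable]: "X \<in> borel_measurable M" using assms by (simp add: gaussian_rv_def)
  consider \<mu> where "AE \<omega> in M. X \<omega> = \<mu>"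
    | \<mu> \<sigma> where "\<sigma> > 0" "distributed M lborel X (normal_density \<mu> \<sigma>)"
    using assms by (auto simp: gaussian_rv_def)
  then show ?thesis
  proof cases
    case 1
    have "sq_integrable M (\<lambda>_. \<mu>)" by (simp add: sq_integrable_def)
    then show ?thesis by (rule sq_integrable_cong_AE) (use 1 in auto)
  next
    case 2
    have "integrable M (\<lambda>\<omega>. (X \<omega> - \<mu>)\<^sup>2)"
      using distributed_integrable[OF 2(2), of "\<lambda>x. (x - \<mu>)\<^sup>2"] integrable_normal_moment[OF 2(1), of \<mu> 2] 2(1)
      by simp
    then have "sq_integrable M (\<lambda>\<omega>. X \<omega> - \<mu>)" by (simp add: sq_integrable_def)
    moreover have "sq_integrable M (\<lambda>_. \<mu>)" by (simp add: sq_integrable_def)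
    ultimately have "sq_integrable M (\<lambda>\<omega>. (X \<omega> - \<mu>) + \<mu>)" by (rule sq_integrable_add)
    then show ?thesis by simp
  qed
qed

lemma gaussian_field_sq_integrable:
  assumes "gaussian_field M F"
  shows "sq_integrable M (F x)"
proof -
  have "gaussian_rv M (\<lambda>\<omega>. \<Sum>x\<in>{x}. 1 * F x \<omega>)"
    using assms unfolding gaussian_field_def by (elim allE[of _ "{x}"] allE[of _ "\<lambda>_. 1"]) auto
  then show ?thesis by (intro gaussian_rv_sq_integrable) simp
qed

lemma char_distr: "X \<in> borel_measurable M \<Longrightarrow> char (distr M borel X) t = (CLINT \<omega>|M. iexp (t * X \<omega>))"
  unfolding char_def by (rule integral_distr) auto

lemma char_standard_normal_rv:
  assumes "distributed M lborel Z std_normal_density"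
  shows "(CLINT \<omega>|M. iexp (t * Z \<omega>)) = exp (- (t\<^sup>2) / 2)"
proof -
  have "Z \<in> borel_measurable M" using assms by (simp add: distributed_def)
  moreover have "distr M borel Z = distr M lborel Z" by (rule distr_cong) auto
  ultimately have "(CLINT \<omega>|M. iexp (t * Z \<omega>)) = char (distr M lborel Z) t"
    using char_distr[of Z t] by simp
  also have "distr M lborel Z = std_normal_distribution"
    using assms by (simp add: distributed_def)
  finally show ?thesis by (simp add: char_std_normal_distribution)
qed

lemma char_centred_gaussian_rv:
  assumes X: "gaussian_rv M X" and mean: "expectation X = 0"
  shows "(CLINT \<omega>|M. iexp (t * X \<omega>)) = exp (- (t\<^sup>2 * l2_inner M X X) / 2)"
proof -
  have meas [measurable]: "X \<in> borel_measurable M" using X by (simp add: gaussian_rv_def)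
  consider \<mu> where "AE \<omega> in M. X \<omega> = \<mu>"
    | \<mu> \<sigma> where "\<sigma> > 0" "distributed M lborel X (normal_density \<mu> \<sigma>)"
    using X by (auto simp: gaussian_rv_def)
  then show ?thesis
  proof cases
    case 1
    have "expectation X = expectation (\<lambda>_. \<mu>)" by (rule integral_cong_AE) (use 1 in auto)
    then have "\<mu> = 0" using mean by (simp add: prob_space)
    then have X0: "AE \<omega> in M. X \<omega> = 0" using 1 by simp
    have "(CLINT \<omega>|M. iexp (t * X \<omega>)) = (CLINT \<omega>|M. 1)"
      by (rule integral_cong_AE) (use X0 in auto)
    moreover have "l2_inner M X X = l2_inner M (\<lambda>_. 0) (\<lambda>_. 0)"
      by (rule l2_inner_cong_AE) (use X0 gaussian_rv_sq_integrable[OF X] in auto)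
    ultimately show ?thesis by (simp add: l2_inner_def prob_space)
  next
    case 2
    have "\<mu> = 0" using normal_distributed_expectation[OF 2] mean by simp
    have var: "l2_inner M X X = \<sigma>\<^sup>2"
      using normal_distributed_variance[OF 2] mean by (simp add: l2_inner_def power2_eq_square)
    have "distributed M lborel (\<lambda>\<omega>. X \<omega> / \<sigma>) std_normal_density"
      using normal_standard_normal_convert[OF 2(1), of X \<mu>] 2(2) \<open>\<mu> = 0\<close> by simp
    from char_standard_normal_rv[OF this, of "t * \<sigma>"] show ?thesis
      using 2(1) by (simp add: var power_mult_distrib)
  qed
qed

text \<open>After normalisation to unit variance, uniqueness of characteristic functions identifies the law.\<close>
lemma gaussian_rv_if_char:
  assumes X: "sq_integrable M X"
    and char: "\<And>t. (CLINT \<omega>|M. iexp (t * X \<omega>)) = exp (- (t\<^sup>2 * l2_inner M X X) / 2)"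
  shows "gaussian_rv M X"
proof -
  have meas [measurable]: "X \<in> borel_measurable M" using X by (simp add: sq_integrable_def)
  show ?thesis
  proof (cases "l2_inner M X X = 0")
    case True
    then show ?thesis using l2_inner_self_eq_0_AE[OF X] by (auto simp: gaussian_rv_def)
  next
    case False
    then have pos: "l2_inner M X X > 0" using l2_inner_self_nonneg[of M X] by linarith
    define \<sigma> where "\<sigma> = sqrt (l2_inner M X X)"
    have \<sigma>: "\<sigma> > 0" "\<sigma>\<^sup>2 = l2_inner M X X" using pos by (auto simp: \<sigma>_def)
    let ?Z = "\<lambda>\<omega>. X \<omega> / \<sigma>"
    have "distr M borel ?Z = std_normal_distribution"
    proof (rule Levy_uniqueness)
      show "real_distribution (distr M borel ?Z)" by (rule real_distribution_distr) measurable
      show "real_distribution std_normal_distribution" by (rule real_dist_normal_dist)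
      show "char (distr M borel ?Z) = char std_normal_distribution"
      proof
        fix t
        have "char (distr M borel ?Z) t = (CLINT \<omega>|M. iexp (t * ?Z \<omega>))" by (rule char_distr) measurable
        also have "\<dots> = (CLINT \<omega>|M. iexp ((t / \<sigma>) * X \<omega>))" by simp
        also have "\<dots> = exp (- (t\<^sup>2) / 2)"
          unfolding char using \<sigma> pos by (simp add: power_divide)
        finally show "char (distr M borel ?Z) t = char std_normal_distribution t"
          by (simp add: char_std_normal_distribution)
      qed
    qed
    moreover have "distr M lborel ?Z = distr M borel ?Z" by (rule distr_cong) auto
    ultimately have "distributed M lborel ?Z std_normal_density"
      by (simp add: distributed_def)
    then have "distributed M lborel X (normal_density 0 \<sigma>)"
      using normal_standard_normal_convert[OF \<sigma>(1), of X 0] by simp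
    then show ?thesis using \<sigma>(1) meas by (auto simp: gaussian_rv_def)
  qed
qed

lemma ms_tendsto_expectation:
  assumes "ms_tendsto M X Y l"
  shows "((\<lambda>t. expectation (X t)) \<longlongrightarrow> expectation Y) l"
  using ms_tendsto_inner_left[OF assms, of "\<lambda>_. 1"] by (simp add: sq_integrable_def l2_inner_def)

text \<open>The map \<open>x \<mapsto> exp (i t x)\<close> is Lipschitz with constant \<open>\<bar>t\<bar>\<close>, and the \<open>L\<^sup>1\<close> distance is at most the
\<open>L\<^sup>2\<close> distance.\<close>
lemma ms_tendsto_char:
  assumes X: "\<And>n. sq_integrable M (X n)" and lim: "ms_tendsto M X Y sequentially"
  shows "(\<lambda>n. CLINT \<omega>|M. iexp (t * X n \<omega>)) \<longlonglongrightarrow> (CLINT \<omega>|M. iexp (t * Y \<omega>))"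
proof -
  have Y: "sq_integrable M Y" using lim by (rule ms_tendsto_sq_integrable)
  have [measurable]: "Y \<in> borel_measurable M" "X n \<in> borel_measurable M" for n
    using X Y by (auto simp: sq_integrable_def)
  have int: "integrable M (\<lambda>\<omega>. iexp (t * Z \<omega>))" if [measurable]: "Z \<in> borel_measurable M" for Z :: "'a \<Rightarrow> real"
    by (rule integrable_const_bound[where B = 1]) auto
  have lip: "norm (iexp a - iexp b) \<le> \<bar>a - b\<bar>" for a b :: real
  proof -
    have "iexp a - iexp b = iexp b * (iexp (a - b) - 1)"
      by (simp add: algebra_simps flip: exp_add)
    then have "norm (iexp a - iexp b) = norm (iexp (a - b) - 1)" by (simp add: norm_mult)
    also have "\<dots> \<le> \<bar>a - b\<bar>" using iexp_approx1[of "a - b" 0] by simp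
    finally show ?thesis .
  qed
  let ?d = "\<lambda>n \<omega>. X n \<omega> - Y \<omega>"
  have bound: "norm ((CLINT \<omega>|M. iexp (t * X n \<omega>)) - (CLINT \<omega>|M. iexp (t * Y \<omega>))) \<le>
      \<bar>t\<bar> * sqrt (l2_inner M (?d n) (?d n))" for n
  proof -
    have "norm ((CLINT \<omega>|M. iexp (t * X n \<omega>)) - (CLINT \<omega>|M. iexp (t * Y \<omega>))) =
        norm (CLINT \<omega>|M. iexp (t * X n \<omega>) - iexp (t * Y \<omega>))"
      by (subst Bochner_Integration.integral_diff) (intro int refl; measurable)+
    also have "\<dots> \<le> (\<integral>\<omega>. norm (iexp (t * X n \<omega>) - iexp (t * Y \<omega>)) \<partial>M)"
      by (rule integral_norm_bound)
    also have "\<dots> \<le> (\<integral>\<omega>. \<bar>t\<bar> * \<bar>?d n \<omega>\<bar> \<partial>M)"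
    proof (rule integral_mono)
      show "integrable M (\<lambda>\<omega>. norm (iexp (t * X n \<omega>) - iexp (t * Y \<omega>)))"
        by (intro integrable_norm Bochner_Integration.integrable_diff int) measurable
      show "integrable M (\<lambda>\<omega>. \<bar>t\<bar> * \<bar>?d n \<omega>\<bar>)"
        using sq_integrable_integrable[OF sq_integrable_diff[OF X[of n] Y]] by simp
      show "norm (iexp (t * X n \<omega>) - iexp (t * Y \<omega>)) \<le> \<bar>t\<bar> * \<bar>?d n \<omega>\<bar>" for \<omega>
        using lip[of "t * X n \<omega>" "t * Y \<omega>"] by (simp add: abs_mult flip: right_diff_distrib)
    qed
    also have "\<dots> = \<bar>t\<bar> * (\<integral>\<omega>. \<bar>?d n \<omega>\<bar> \<partial>M)" by simp
    also have "\<dots> \<le> \<bar>t\<bar> * sqrt (l2_inner M (?d n) (?d n))"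
      by (intro mult_left_mono l2_abs_expectation_le) (auto simp: X Y)
    finally show ?thesis .
  qed
  have "(\<lambda>n. \<bar>t\<bar> * sqrt (l2_inner M (?d n) (?d n))) \<longlonglongrightarrow> \<bar>t\<bar> * sqrt 0"
    using lim by (intro tendsto_intros) (simp add: ms_tendsto_iff)
  then have "(\<lambda>n. \<bar>t\<bar> * sqrt (l2_inner M (?d n) (?d n))) \<longlonglongrightarrow> 0" by simp
  from Lim_null_comparison[OF always_eventually[OF allI[OF bound]] this] show ?thesis
    by (rule LIM_zero_cancel)
qed

text \<open>Finite combinations have characteristic functions \<open>exp (- t\<^sup>2 \<sigma>\<^sub>n\<^sup>2 / 2)\<close>. This formula passes to the
mean-square limit, because the variances converge as well; a variance that vanishes in the limit yields a
degenerate Gaussian.\<close>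
lemma gaussian_closed_span:
  assumes gauss: "gaussian_field M F" and mean: "\<And>x. expectation (F x) = 0"
    and X: "X \<in> l2_closed_span M F"
  shows "gaussian_rv M X" "expectation X = 0"
proof -
  have F: "sq_integrable M (F x)" for x by (rule gaussian_field_sq_integrable[OF gauss])
  obtain Y where Y: "\<And>n. Y n \<in> l2_span F" and lim: "ms_tendsto M Y X sequentially"
    using l2_closed_span_sequence[OF F X] by metis
  have sqY: "sq_integrable M (Y n)" for n by (rule l2_span_sq_integrable[OF F Y])
  have sqX: "sq_integrable M X" using lim by (rule ms_tendsto_sq_integrable)
  have Y0: "expectation (Y n) = 0" for n
  proof -
    obtain S c where "finite S" "Y n = (\<lambda>\<omega>. \<Sum>x\<in>S. c x * F x \<omega>)"
      using Y[of n] by (auto simp: l2_span_def)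
    then show ?thesis by (simp add: sq_integrable_integrable F mean)
  qed
  have gY: "gaussian_rv M (Y n)" for n
    using Y[of n] gauss by (auto simp: l2_span_def gaussian_field_def)
  show "expectation X = 0"
    using LIMSEQ_unique[OF ms_tendsto_expectation[OF lim]] by (simp add: Y0)
  show "gaussian_rv M X"
  proof (rule gaussian_rv_if_char[OF sqX])
    fix t
    have "(\<lambda>n. complex_of_real (exp (- (t\<^sup>2 * l2_inner M (Y n) (Y n)) / 2))) \<longlonglongrightarrow>
        complex_of_real (exp (- (t\<^sup>2 * l2_inner M X X) / 2))"
      by (intro tendsto_intros ms_tendsto_inner[OF lim lim]) auto
    moreover have "(\<lambda>n. complex_of_real (exp (- (t\<^sup>2 * l2_inner M (Y n) (Y n)) / 2))) \<longlonglongrightarrow>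
        (CLINT \<omega>|M. iexp (t * X \<omega>))"
      using ms_tendsto_char[OF sqY lim, of t] unfolding char_centred_gaussian_rv[OF gY Y0] .
    ultimately show "(CLINT \<omega>|M. iexp (t * X \<omega>)) = exp (- (t\<^sup>2 * l2_inner M X X) / 2)"
      using LIMSEQ_unique by blast
  qed
qed

end

section \<open>Second moments of the derivatives of an isotropic field\<close>

text \<open>The outer function is differentiable only one-sidedly at 0. This suffices because
\<open>t \<mapsto> \<parallel>r + t e\<parallel>\<^sup>2\<close> never leaves the half-line.\<close>
lemma has_real_derivative_comp_norm_sq:
  fixes r e :: "'b::real_inner"
  assumes g: "\<And>t. t \<ge> 0 \<Longrightarrow> (g has_real_derivative g' t) (at t within {0..})"
  shows "((\<lambda>t. g ((norm (r + t *\<^sub>R e))\<^sup>2)) has_real_derivative g' ((norm r)\<^sup>2) * (2 * (r \<bullet> e))) (at 0)"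
proof -
  let ?q = "\<lambda>t. (norm (r + t *\<^sub>R e))\<^sup>2"
  have q: "?q = (\<lambda>t. r \<bullet> r + 2 * t * (r \<bullet> e) + t\<^sup>2 * (e \<bullet> e))"
    unfolding power2_norm_eq_inner
    by (auto simp: inner_simps inner_commute[of e r] power2_eq_square algebra_simps)
  have "(?q has_real_derivative 2 * (r \<bullet> e)) (at 0)"
    unfolding q by (auto intro!: derivative_eq_intros)
  moreover have "(g has_real_derivative g' (?q 0)) (at (?q 0) within (range ?q))"
    by (rule has_field_derivative_subset[OF g]) auto
  ultimately have "(g \<circ> ?q has_real_derivative g' (?q 0) * (2 * (r \<bullet> e))) (at 0)"
    by (intro DERIV_image_chain)
  then show ?thesis by (simp add: o_def)
qed

lemma has_real_derivative_even_eq_0: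
  fixes g :: "real \<Rightarrow> real"
  assumes D: "(g has_real_derivative D) (at 0)" and even: "\<And>t. g (- t) = g t"
  shows "D = 0"
proof -
  have "(g has_real_derivative D) (at (- 0))" using D by simp
  then have "((\<lambda>t. g (- t)) has_real_derivative - D) (at 0)" by (rule iffD1[OF DERIV_mirror])
  then have "(g has_real_derivative - D) (at 0)" by (simp add: even)
  from DERIV_unique[OF D this] show ?thesis by simp
qed

text \<open>A centred covariance is the inner product itself; working with the latter keeps Gaussianity and
expectations out of the second-moment computations.\<close>
locale isotropic_field = prob_space M for M :: "'w measure" +
  fixes u :: "'b::real_inner \<Rightarrow> 'w \<Rightarrow> real" and h h' h'' :: "real \<Rightarrow> real"
  assumes sq_u: "sq_integrable M (u x)"
    and cov_u: "l2_inner M (u x) (u y) = h ((norm (x - y))\<^sup>2)"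
    and smooth_u: "cont_differentiable 4 (\<lambda>(x, y). l2_inner M (u x) (u y))"
    and h': "t \<ge> 0 \<Longrightarrow> (h has_real_derivative h' t) (at t within {0..})"
    and h'': "t \<ge> 0 \<Longrightarrow> (h' has_real_derivative h'' t) (at t within {0..})"
    and cont_h'': "continuous_on {0..} h''"
begin

abbreviation D1 :: "'b \<Rightarrow> 'b \<Rightarrow> 'w \<Rightarrow> real" where
  "D1 e \<equiv> ms_deriv M e u"

abbreviation D2 :: "'b \<Rightarrow> 'b \<Rightarrow> 'b \<Rightarrow> 'w \<Rightarrow> real" where
  "D2 d e \<equiv> ms_deriv M d (ms_deriv M e u)"

lemma has_D1: "has_ms_derivative M u e x (D1 e x)"
  by (rule ms_deriv_works[of _ 2]) (use sq_u smooth_u in \<open>simp_all add: eval_nat_numeral\<close>)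

lemma sq_D1 [simp]: "sq_integrable M (D1 e x)"
  using has_D1 by (rule has_ms_derivative_sq_integrable)

lemma has_D2: "has_ms_derivative M (D1 e) d x (D2 d e x)"
proof (rule ms_deriv_works[of _ 0])
  have "cont_differentiable 2 (\<lambda>(x, y). l2_inner M (D1 e x) (D1 e y))"
    by (rule cont_differentiable_covariance_ms_deriv)
      (use sq_u smooth_u in \<open>simp_all add: eval_nat_numeral\<close>)
  then show "cont_differentiable (Suc (Suc 0)) (\<lambda>(x, y). l2_inner M (D1 e x) (D1 e y))"
    by (simp add: eval_nat_numeral)
qed simp

lemma sq_D2 [simp]: "sq_integrable M (D2 d e x)"
  using has_D2 by (rule has_ms_derivative_sq_integrable)

lemma D1_closed_span: "D1 e x \<in> l2_closed_span M u"
  by (rule has_ms_derivative_closed_span[OF sq_u l2_closed_span_base[OF sq_u] has_D1])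

lemma D2_closed_span: "D2 d e x \<in> l2_closed_span M u"
  by (rule has_ms_derivative_closed_span[OF sq_u D1_closed_span has_D2])

lemma inner_D1_u: "l2_inner M (D1 e x) (u y) = 2 * h' ((norm (x - y))\<^sup>2) * ((x - y) \<bullet> e)"
proof (rule has_ms_derivative_inner_eq[OF sq_u has_D1 sq_u])
  have shift: "(x + t *\<^sub>R e) - y = (x - y) + t *\<^sub>R e" for t by simp
  show "((\<lambda>t. l2_inner M (u (x + t *\<^sub>R e)) (u y)) has_real_derivative
      2 * h' ((norm (x - y))\<^sup>2) * ((x - y) \<bullet> e)) (at 0)"
    unfolding cov_u shift using has_real_derivative_comp_norm_sq[of h h', OF h', of "x - y" e]
    by (simp add: mult_ac)
qed

lemma has_derivative_first_moment:
  "((\<lambda>t. 2 * h' ((norm (r + t *\<^sub>R d))\<^sup>2) * ((r + t *\<^sub>R d) \<bullet> e)) has_real_derivative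
     4 * h'' ((norm r)\<^sup>2) * (r \<bullet> d) * (r \<bullet> e) + 2 * h' ((norm r)\<^sup>2) * (d \<bullet> e)) (at 0)"
proof -
  have 1: "((\<lambda>t. h' ((norm (r + t *\<^sub>R d))\<^sup>2)) has_real_derivative h'' ((norm r)\<^sup>2) * (2 * (r \<bullet> d))) (at 0)"
    by (rule has_real_derivative_comp_norm_sq[OF h''])
  have 2: "((\<lambda>t. (r + t *\<^sub>R d) \<bullet> e) has_real_derivative d \<bullet> e) (at 0)"
    unfolding inner_add_left inner_scaleR_left by (auto intro!: derivative_eq_intros)
  show ?thesis
    using DERIV_cmult[OF DERIV_mult[OF 1 2], of 2]
    by (simp add: algebra_simps)
qed

text \<open>The derivative in the second point acts on \<open>x - y\<close> with direction \<open>- d\<close>, which is the origin of the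
signs.\<close>
lemma inner_D1_D1:
  "l2_inner M (D1 e x) (D1 d y) =
     - 4 * h'' ((norm (x - y))\<^sup>2) * ((x - y) \<bullet> d) * ((x - y) \<bullet> e) - 2 * h' ((norm (x - y))\<^sup>2) * (d \<bullet> e)"
proof -
  have shift: "x - (y + t *\<^sub>R d) = (x - y) + t *\<^sub>R (- d)" for t by simp
  have "((\<lambda>t. l2_inner M (u (y + t *\<^sub>R d)) (D1 e x)) has_real_derivative
      - 4 * h'' ((norm (x - y))\<^sup>2) * ((x - y) \<bullet> d) * ((x - y) \<bullet> e) - 2 * h' ((norm (x - y))\<^sup>2) * (d \<bullet> e)) (at 0)"
    unfolding l2_inner_commute[of M _ "D1 e x"] inner_D1_u shift
    using has_derivative_first_moment[of "x - y" "- d" e] by simp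
  from has_ms_derivative_inner_eq[OF sq_u has_D1 sq_D1 this]
  show ?thesis by (simp add: l2_inner_commute)
qed

lemma inner_D2_u:
  "l2_inner M (D2 d e x) (u y) =
     4 * h'' ((norm (x - y))\<^sup>2) * ((x - y) \<bullet> d) * ((x - y) \<bullet> e) + 2 * h' ((norm (x - y))\<^sup>2) * (d \<bullet> e)"
proof (rule has_ms_derivative_inner_eq[OF sq_D1 has_D2 sq_u])
  have shift: "(x + t *\<^sub>R d) - y = (x - y) + t *\<^sub>R d" for t by simp
  show "((\<lambda>t. l2_inner M (D1 e (x + t *\<^sub>R d)) (u y)) has_real_derivative
      4 * h'' ((norm (x - y))\<^sup>2) * ((x - y) \<bullet> d) * ((x - y) \<bullet> e) + 2 * h' ((norm (x - y))\<^sup>2) * (d \<bullet> e)) (at 0)"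
    unfolding inner_D1_u shift using has_derivative_first_moment[of "x - y" d e] by simp
qed

text \<open>By stationarity, the covariance is the derivative at 0 of an even function of the displacement.\<close>
lemma inner_D2_D1_same: "l2_inner M (D2 d e z) (D1 c z) = 0"
proof (rule has_real_derivative_even_eq_0)
  show "((\<lambda>t. l2_inner M (D1 e (z + t *\<^sub>R d)) (D1 c z)) has_real_derivative
      l2_inner M (D2 d e z) (D1 c z)) (at 0)"
    by (rule has_ms_derivative_inner[OF sq_D1 has_D2 sq_D1])
  show "l2_inner M (D1 e (z + (- t) *\<^sub>R d)) (D1 c z) = l2_inner M (D1 e (z + t *\<^sub>R d)) (D1 c z)" for t
    by (simp add: inner_D1_D1)
qed

text \<open>The fourth derivative of \<open>h (\<parallel>r\<parallel>\<^sup>2)\<close> at the origin is needed although \<open>h\<close> is only twice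
differentiable. The covariance of first derivatives already contains \<open>h'\<close> and \<open>h''\<close>, and its
second-order expansion at \<open>r = 0\<close> uses only that \<open>h'\<close> is differentiable and \<open>h''\<close> continuous at 0.\<close>
lemma covariance_D1_second_order:
  "((\<lambda>t. (l2_inner M (D1 b (x + t *\<^sub>R r)) (D1 d x) - l2_inner M (D1 b x) (D1 d x)) / t\<^sup>2) \<longlongrightarrow>
     - 4 * h'' 0 * (r \<bullet> b) * (r \<bullet> d) - 2 * h'' 0 * (r \<bullet> r) * (b \<bullet> d)) (at 0)"
proof -
  let ?n = "\<lambda>t. t\<^sup>2 * (r \<bullet> r)"
  have "isCont ?n 0" by (intro continuous_intros)
  then have n0: "(?n \<longlongrightarrow> 0) (at 0)" by (simp add: isCont_def)
  have lim2: "((\<lambda>t. h'' (?n t)) \<longlongrightarrow> h'' 0) (at 0)"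
    by (rule continuous_on_tendsto_compose[OF cont_h'' n0]) auto
  have lim1: "((\<lambda>t. (h' (?n t) - h' 0) / t\<^sup>2) \<longlongrightarrow> h'' 0 * (r \<bullet> r)) (at 0)"
  proof (cases "r = 0")
    case True
    then show ?thesis by simp
  next
    case False
    have D: "((\<lambda>y. (h' y - h' 0) / (y - 0)) \<longlongrightarrow> h'' 0) (at 0 within {0..})"
      using h''[of 0] by (simp add: has_field_derivative_iff)
    (* the squared norm approaches 0 through positive values, where the one-sided quotient lives *)
    have "filterlim ?n (at 0 within {0..}) (at 0)"
      unfolding filterlim_at using n0 False by (auto simp: eventually_at intro!: exI[of _ 1])
    from filterlim_compose[OF D this]
    have "((\<lambda>t. (h' (?n t) - h' 0) / (?n t - 0) * (r \<bullet> r)) \<longlongrightarrow> h'' 0 * (r \<bullet> r)) (at 0)"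
      by (rule tendsto_mult_right)
    moreover have "(h' (?n t) - h' 0) / (?n t - 0) * (r \<bullet> r) = (h' (?n t) - h' 0) / t\<^sup>2" for t
      using False by simp
    ultimately show ?thesis by simp
  qed
  have "((\<lambda>t. - 4 * h'' (?n t) * (r \<bullet> b) * (r \<bullet> d) - 2 * ((h' (?n t) - h' 0) / t\<^sup>2) * (b \<bullet> d)) \<longlongrightarrow>
      - 4 * h'' 0 * (r \<bullet> b) * (r \<bullet> d) - 2 * (h'' 0 * (r \<bullet> r)) * (b \<bullet> d)) (at 0)"
    by (intro tendsto_intros lim1 lim2)
  then have lim: "((\<lambda>t. - 4 * h'' (?n t) * (r \<bullet> b) * (r \<bullet> d) - 2 * ((h' (?n t) - h' 0) / t\<^sup>2) * (b \<bullet> d)) \<longlongrightarrow>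
      - 4 * h'' 0 * (r \<bullet> b) * (r \<bullet> d) - 2 * h'' 0 * (r \<bullet> r) * (b \<bullet> d)) (at 0)" by (simp add: mult.assoc)
  show ?thesis
  proof (rule Lim_transform_eventually[OF lim])
    have "- 4 * h'' (?n t) * (r \<bullet> b) * (r \<bullet> d) - 2 * ((h' (?n t) - h' 0) / t\<^sup>2) * (b \<bullet> d) =
        (l2_inner M (D1 b (x + t *\<^sub>R r)) (D1 d x) - l2_inner M (D1 b x) (D1 d x)) / t\<^sup>2" if "t \<noteq> 0" for t
    proof -
      have nn: "(norm (t *\<^sub>R r))\<^sup>2 = ?n t" by (simp add: power_mult_distrib power2_norm_eq_inner)
      have "l2_inner M (D1 b (x + t *\<^sub>R r)) (D1 d x) - l2_inner M (D1 b x) (D1 d x) =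
          - 4 * h'' (?n t) * (t * (r \<bullet> d)) * (t * (r \<bullet> b)) - 2 * (h' (?n t) - h' 0) * (d \<bullet> b)"
        by (simp only: inner_D1_D1 add_diff_cancel_left' nn) (simp add: algebra_simps)
      then show ?thesis
        using that by (simp add: field_simps power2_eq_square inner_commute[of d b])
    qed
    then show "\<forall>\<^sub>F t in at 0. - 4 * h'' (?n t) * (r \<bullet> b) * (r \<bullet> d) - 2 * ((h' (?n t) - h' 0) / t\<^sup>2) * (b \<bullet> d) =
        (l2_inner M (D1 b (x + t *\<^sub>R r)) (D1 d x) - l2_inner M (D1 b x) (D1 d x)) / t\<^sup>2"
      by (auto simp: eventually_at intro!: exI[of _ 1])
  qed
qed

text \<open>The covariance of the two difference quotients at a common step depends, by stationarity, on the
increments \<open>a - c\<close>, \<open>a\<close> and \<open>- c\<close>. In the limit it is the polarisation of the quadratic form of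
the preceding expansion. The result is symmetric in the four directions, as a fourth derivative
should be.\<close>
lemma inner_D2_D2_same:
  "l2_inner M (D2 a b z) (D2 c d z) =
     4 * h'' 0 * ((a \<bullet> b) * (c \<bullet> d) + (a \<bullet> c) * (b \<bullet> d) + (a \<bullet> d) * (b \<bullet> c))"
proof -
  let ?Q = "\<lambda>r. - 4 * h'' 0 * (r \<bullet> b) * (r \<bullet> d) - 2 * h'' 0 * (r \<bullet> r) * (b \<bullet> d)"
  let ?R = "\<lambda>r t. (l2_inner M (D1 b (z + t *\<^sub>R r)) (D1 d z) - l2_inner M (D1 b z) (D1 d z)) / t\<^sup>2"
  let ?X = "\<lambda>t \<omega>. (D1 b (z + t *\<^sub>R a) \<omega> - D1 b z \<omega>) / t"
  let ?Y = "\<lambda>t \<omega>. (D1 d (z + t *\<^sub>R c) \<omega> - D1 d z \<omega>) / t"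
  have "((\<lambda>t. l2_inner M (?X t) (?Y t)) \<longlongrightarrow> l2_inner M (D2 a b z) (D2 c d z)) (at 0)"
    using has_D2[of b a z] has_D2[of d c z] unfolding has_ms_derivative_def
    by (rule ms_tendsto_inner)
  moreover have "l2_inner M (?X t) (?Y t) = ?R (a - c) t - ?R a t - ?R (- c) t" for t
  proof -
    have shift: "l2_inner M (D1 b (z + t *\<^sub>R a)) (D1 d (z + t *\<^sub>R c)) =
        l2_inner M (D1 b (z + t *\<^sub>R (a - c))) (D1 d z)"
      by (simp add: inner_D1_D1 algebra_simps)
    have shift': "l2_inner M (D1 b z) (D1 d (z + t *\<^sub>R c)) =
        l2_inner M (D1 b (z + t *\<^sub>R (- c))) (D1 d z)"
      by (simp add: inner_D1_D1)
    show ?thesis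
      by (simp only: l2_inner_divide_left l2_inner_divide_right l2_inner_diff_left l2_inner_diff_right
          sq_D1 sq_integrable_diff shift shift')
        (simp add: power2_eq_square diff_divide_distrib)
  qed
  moreover have "((\<lambda>t. ?R (a - c) t - ?R a t - ?R (- c) t) \<longlongrightarrow> ?Q (a - c) - ?Q a - ?Q (- c)) (at 0)"
    by (intro tendsto_diff covariance_D1_second_order)
  ultimately have "l2_inner M (D2 a b z) (D2 c d z) = ?Q (a - c) - ?Q a - ?Q (- c)"
    using tendsto_unique[OF trivial_limit_at] by simp
  then show ?thesis
    by (simp add: inner_simps inner_commute[of c a] inner_commute[of c b] algebra_simps)
qed

end

section \<open>Linearity of mean-square derivatives in the direction\<close>

lemma inner_sum_sum:
  fixes e f :: "'i \<Rightarrow> 'b::real_inner"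
  shows "(\<Sum>i\<in>I. v i *\<^sub>R e i) \<bullet> (\<Sum>j\<in>J. w j *\<^sub>R f j) = (\<Sum>i\<in>I. \<Sum>j\<in>J. v i * w j * (e i \<bullet> f j))"
  by (subst inner_sum_left) (simp add: inner_sum_right sum_distrib_left mult_ac)

context isotropic_field
begin

text \<open>Versions of mean-square derivatives are chosen separately for each direction, so linearity in the
direction can hold only almost surely. It follows from linearity of the covariances.\<close>
lemma D1_sum:
  assumes "finite I"
  shows "AE \<omega> in M. (\<Sum>i\<in>I. c i * D1 (e i) z \<omega>) = D1 (\<Sum>i\<in>I. c i *\<^sub>R e i) z \<omega>"
proof -
  let ?s = "\<Sum>i\<in>I. c i *\<^sub>R e i"
  let ?Y = "\<lambda>\<omega>. (\<Sum>i\<in>I. c i * D1 (e i) z \<omega>) - D1 ?s z \<omega>"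
  have "AE \<omega> in M. ?Y \<omega> = 0"
  proof (rule l2_span_orthogonal_AE_zero)
    show "?Y \<in> l2_span (\<lambda>e. D1 e z)"
      by (intro l2_span_diff l2_span_sum l2_span_scale l2_span_base)
    have "l2_inner M ?Y (D1 d z) = (\<Sum>i\<in>I. c i * (- 2 * h' 0 * (d \<bullet> e i))) - (- 2 * h' 0 * (d \<bullet> ?s))" for d
      by (simp add: l2_inner_diff_left l2_inner_sum_left l2_inner_scale_left inner_D1_D1)
    then show "l2_inner M ?Y (D1 d z) = 0" for d
      by (simp add: inner_sum_right sum_distrib_left sum_negf mult_ac)
  qed simp
  then show ?thesis by simp
qed

lemma D1_diff: "AE \<omega> in M. D1 e z \<omega> - D1 e' z \<omega> = D1 (e - e') z \<omega>"
proof -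
  let ?Y = "\<lambda>\<omega>. (D1 e z \<omega> - D1 e' z \<omega>) - D1 (e - e') z \<omega>"
  have "AE \<omega> in M. ?Y \<omega> = 0"
  proof (rule l2_span_orthogonal_AE_zero)
    show "?Y \<in> l2_span (\<lambda>e. D1 e z)" by (intro l2_span_diff l2_span_base)
    show "l2_inner M ?Y (D1 d z) = 0" for d
      by (simp only: l2_inner_diff_left sq_D1 sq_integrable_diff inner_D1_D1)
        (simp add: inner_diff_right algebra_simps)
  qed simp
  then show ?thesis by simp
qed

lemma D2_orthogonal_AE_zero:
  assumes Y: "Y \<in> l2_span (\<lambda>(a, b). D2 a b z)" and orth: "\<And>c d. l2_inner M Y (D2 c d z) = 0"
  shows "AE \<omega> in M. Y \<omega> = 0"
  by (rule l2_span_orthogonal_AE_zero[OF _ Y]) (auto simp: orth)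

lemma D2_in_span: "D2 a b z \<in> l2_span (\<lambda>(a, b). D2 a b z)"
  using l2_span_base[of "\<lambda>(a, b). D2 a b z" "(a, b)"] by simp

text \<open>Almost sure bilinearity, again because the covariance with every \<open>D2 c d z\<close> is bilinear in the pair
of directions.\<close>
lemma D2_sum:
  assumes "finite I"
  shows "AE \<omega> in M. (\<Sum>i\<in>I. \<Sum>j\<in>I. v i * w j * D2 (e i) (f j) z \<omega>) =
    D2 (\<Sum>i\<in>I. v i *\<^sub>R e i) (\<Sum>j\<in>I. w j *\<^sub>R f j) z \<omega>"
proof -
  let ?a = "\<Sum>i\<in>I. v i *\<^sub>R e i" and ?b = "\<Sum>j\<in>I. w j *\<^sub>R f j"
  let ?Y = "\<lambda>\<omega>. (\<Sum>i\<in>I. \<Sum>j\<in>I. v i * w j * D2 (e i) (f j) z \<omega>) - D2 ?a ?b z \<omega>"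
  have "AE \<omega> in M. ?Y \<omega> = 0"
  proof (rule D2_orthogonal_AE_zero)
    show "?Y \<in> l2_span (\<lambda>(a, b). D2 a b z)"
      by (intro l2_span_diff l2_span_sum l2_span_scale D2_in_span)
    fix c d
    have prod: "(?a \<bullet> p) * (?b \<bullet> q) = (\<Sum>i\<in>I. \<Sum>j\<in>I. v i * w j * ((e i \<bullet> p) * (f j \<bullet> q)))" for p q
      by (simp add: inner_sum_left sum_product mult_ac)
    have "l2_inner M ?Y (D2 c d z) =
        (\<Sum>i\<in>I. \<Sum>j\<in>I. v i * w j * (4 * h'' 0 * ((e i \<bullet> f j) * (c \<bullet> d) + (e i \<bullet> c) * (f j \<bullet> d) + (e i \<bullet> d) * (f j \<bullet> c))))
        - 4 * h'' 0 * ((?a \<bullet> ?b) * (c \<bullet> d) + (?a \<bullet> c) * (?b \<bullet> d) + (?a \<bullet> d) * (?b \<bullet> c))"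
      by (simp add: l2_inner_diff_left l2_inner_sum_left l2_inner_scale_left inner_D2_D2_same)
    also have "(\<Sum>i\<in>I. \<Sum>j\<in>I. v i * w j * (4 * h'' 0 * ((e i \<bullet> f j) * (c \<bullet> d) + (e i \<bullet> c) * (f j \<bullet> d) + (e i \<bullet> d) * (f j \<bullet> c)))) =
        4 * h'' 0 * ((?a \<bullet> ?b) * (c \<bullet> d) + (?a \<bullet> c) * (?b \<bullet> d) + (?a \<bullet> d) * (?b \<bullet> c))"
      unfolding prod inner_sum_sum
      by (simp add: sum_distrib_left sum_distrib_right sum.distrib[symmetric] algebra_simps)
    finally show "l2_inner M ?Y (D2 c d z) = 0" by simp
  qed
  then show ?thesis by simp
qed

end

section \<open>The Taylor approximation of a block isotropic field\<close>

lemma swap_line: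
  "prod.swap (x + t *\<^sub>R e) = prod.swap x + t *\<^sub>R prod.swap e"
  for x e :: "'p::real_vector \<times> 'p"
  by (cases x; cases e) simp

lemma has_ms_derivative_block_field:
  fixes F :: "('p::real_vector) \<times> 'p \<Rightarrow> 'w \<Rightarrow> real"
  assumes "has_ms_derivative M F e x Y" "has_ms_derivative M F (prod.swap e) (prod.swap x) Y'"
  shows "has_ms_derivative M (block_field F) e x (\<lambda>\<omega>. Y \<omega> - Y' \<omega>)"
proof -
  have "(\<lambda>t \<omega>. (block_field F (x + t *\<^sub>R e) \<omega> - block_field F x \<omega>) / t) =
      (\<lambda>t \<omega>. (F (x + t *\<^sub>R e) \<omega> - F x \<omega>) / t -
         (F (prod.swap x + t *\<^sub>R prod.swap e) \<omega> - F (prod.swap x) \<omega>) / t)"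
    by (simp add: block_field_def swap_line fun_eq_iff diff_divide_distrib)
  then show ?thesis
    using assms ms_tendsto_diff unfolding has_ms_derivative_def by fastforce
qed

lemma inner_matrix_vector:
  fixes A :: "real^'n^'m"
  shows "v \<bullet> (A *v w) = (\<Sum>i\<in>UNIV. \<Sum>j\<in>UNIV. v $ i * w $ j * A $ i $ j)"
  by (simp add: inner_vec_def matrix_vector_mult_def sum_distrib_left mult_ac)

lemma sum_dir1: "(\<Sum>i\<in>UNIV. v $ i *\<^sub>R dir1 i) = (v, 0)"
  by (simp add: prod_eq_iff fst_sum snd_sum dir1_def vec_eq_iff axis_def if_distrib cong: if_cong)

lemma sum_dir2: "(\<Sum>i\<in>UNIV. v $ i *\<^sub>R dir2 i) = (0, v)"
  by (simp add: prod_eq_iff fst_sum snd_sum dir2_def vec_eq_iff axis_def if_distrib cong: if_cong)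

lemma swap_dir [simp]: "prod.swap (dir1 i) = dir2 i" "prod.swap (dir2 i) = dir1 i"
  by (simp_all add: dir1_def dir2_def)

locale block_isotropic_field = isotropic_field M u h h' h''
  for M :: "'w measure" and u :: "(real^'n::finite) \<times> (real^'n) \<Rightarrow> 'w \<Rightarrow> real"
    and h h' h'' :: "real \<Rightarrow> real"
begin

lemma has_block_derivative:
  "has_ms_derivative M (block_field u) e x (\<lambda>\<omega>. D1 e x \<omega> - D1 (prod.swap e) (prod.swap x) \<omega>)"
  by (rule has_ms_derivative_block_field[OF has_D1 has_D1])

lemma sq_ms_deriv_block [simp]: "sq_integrable M (ms_deriv M e (block_field u) x)"
  by (rule has_ms_derivative_sq_integrable[OF has_ms_derivative_ms_deriv[OF has_block_derivative]])

lemma ms_deriv_block: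
  "AE \<omega> in M. ms_deriv M e (block_field u) x \<omega> = D1 e x \<omega> - D1 (prod.swap e) (prod.swap x) \<omega>"
  by (rule has_ms_derivative_unique[OF has_ms_derivative_ms_deriv[OF has_block_derivative] has_block_derivative])

text \<open>The chosen version of the first derivative agrees with the explicit one only almost surely at each
point, which does not affect the difference quotients in \<open>L\<^sup>2\<close>.\<close>
lemma has_block_second_derivative:
  "has_ms_derivative M (ms_deriv M e (block_field u)) d x
     (\<lambda>\<omega>. D2 d e x \<omega> - D2 (prod.swap d) (prod.swap e) (prod.swap x) \<omega>)"
proof (rule has_ms_derivative_cong_AE)
  let ?F = "\<lambda>x \<omega>. D1 e x \<omega> - D1 (prod.swap e) (prod.swap x) \<omega>"
  have swapped: "ms_tendsto M
      (\<lambda>t \<omega>. (D1 (prod.swap e) (prod.swap x + t *\<^sub>R prod.swap d) \<omega> - D1 (prod.swap e) (prod.swap x) \<omega>) / t)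
      (D2 (prod.swap d) (prod.swap e) (prod.swap x)) (at 0)"
    using has_D2 by (simp add: has_ms_derivative_def)
  have direct: "ms_tendsto M (\<lambda>t \<omega>. (D1 e (x + t *\<^sub>R d) \<omega> - D1 e x \<omega>) / t) (D2 d e x) (at 0)"
    using has_D2 by (simp add: has_ms_derivative_def)
  have "(\<lambda>t \<omega>. (?F (x + t *\<^sub>R d) \<omega> - ?F x \<omega>) / t) =
      (\<lambda>t \<omega>. (D1 e (x + t *\<^sub>R d) \<omega> - D1 e x \<omega>) / t -
        (D1 (prod.swap e) (prod.swap x + t *\<^sub>R prod.swap d) \<omega> - D1 (prod.swap e) (prod.swap x) \<omega>) / t)"
    by (simp add: swap_line fun_eq_iff diff_divide_distrib)
  then show "has_ms_derivative M ?F d x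
      (\<lambda>\<omega>. D2 d e x \<omega> - D2 (prod.swap d) (prod.swap e) (prod.swap x) \<omega>)"
    using ms_tendsto_diff[OF direct swapped] by (simp only: has_ms_derivative_def)
  show "AE \<omega> in M. ?F x \<omega> = ms_deriv M e (block_field u) x \<omega>" for x
    using ms_deriv_block[of e x] by eventually_elim simp
qed simp

lemma sq_ms_deriv2_block [simp]: "sq_integrable M (ms_deriv M d (ms_deriv M e (block_field u)) x)"
  by (rule has_ms_derivative_sq_integrable[OF has_ms_derivative_ms_deriv[OF has_block_second_derivative]])

lemma ms_deriv2_block:
  "AE \<omega> in M. ms_deriv M d (ms_deriv M e (block_field u)) x \<omega> =
     D2 d e x \<omega> - D2 (prod.swap d) (prod.swap e) (prod.swap x) \<omega>"
  by (rule has_ms_derivative_unique[OF has_ms_derivative_ms_deriv[OF has_block_second_derivative]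
        has_block_second_derivative])

lemma skew_taylor2_expand:
  fixes zs x1 x2 v w :: "real^'n"
  defines "v \<equiv> x1 - zs" and "w \<equiv> x2 - zs"
  shows "skew_taylor2 M f zs (x1, x2) \<omega> =
    (\<Sum>i\<in>UNIV. (v - w) $ i * ms_deriv M (dir1 i) f (zs, zs) \<omega>)
    + (1/2 * ((\<Sum>i\<in>UNIV. \<Sum>j\<in>UNIV. v $ i * v $ j * ms_deriv M (dir1 i) (ms_deriv M (dir1 j) f) (zs, zs) \<omega>)
        - (\<Sum>i\<in>UNIV. \<Sum>j\<in>UNIV. w $ i * w $ j * ms_deriv M (dir1 i) (ms_deriv M (dir1 j) f) (zs, zs) \<omega>))
      + (\<Sum>i\<in>UNIV. \<Sum>j\<in>UNIV. v $ i * w $ j * ms_deriv M (dir1 i) (ms_deriv M (dir2 j) f) (zs, zs) \<omega>))"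
proof -
  have "grad1 M f zs \<omega> \<bullet> p = (\<Sum>i\<in>UNIV. p $ i * ms_deriv M (dir1 i) f (zs, zs) \<omega>)" for p
    by (simp add: inner_vec_def grad1_def mult.commute)
  then show ?thesis
    by (simp add: skew_taylor2_def Let_def v_def w_def inner_matrix_vector hess11_def hess12_def)
qed

lemma sq_skew_taylor2: "sq_integrable M (skew_taylor2 M (block_field u) zs (x1, x2))"
  unfolding skew_taylor2_expand
  by (intro sq_integrable_add sq_integrable_diff sq_integrable_sum sq_integrable_scale
      sq_ms_deriv_block sq_ms_deriv2_block)

lemma gradient_term:
  "AE \<omega> in M. (\<Sum>i\<in>UNIV. p $ i * ms_deriv M (dir1 i) (block_field u) (zs, zs) \<omega>) = D1 (p, - p) (zs, zs) \<omega>"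
proof -
  have "AE \<omega> in M. \<forall>i. ms_deriv M (dir1 i) (block_field u) (zs, zs) \<omega> =
      D1 (dir1 i) (zs, zs) \<omega> - D1 (dir2 i) (zs, zs) \<omega>"
    using ms_deriv_block[of "dir1 _" "(zs, zs)"] by (simp add: AE_all_countable)
  moreover have "AE \<omega> in M. (\<Sum>i\<in>UNIV. p $ i * D1 (dir1 i) (zs, zs) \<omega>) = D1 (p, 0) (zs, zs) \<omega>"
    using D1_sum[OF finite[of UNIV], of "\<lambda>i. p $ i" dir1 "(zs, zs)"] by (simp add: sum_dir1)
  moreover have "AE \<omega> in M. (\<Sum>i\<in>UNIV. p $ i * D1 (dir2 i) (zs, zs) \<omega>) = D1 (0, p) (zs, zs) \<omega>"
    using D1_sum[OF finite[of UNIV], of "\<lambda>i. p $ i" dir2 "(zs, zs)"] by (simp add: sum_dir2)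
  moreover have "AE \<omega> in M. D1 (p, 0) (zs, zs) \<omega> - D1 (0, p) (zs, zs) \<omega> = D1 (p, - p) (zs, zs) \<omega>"
    using D1_diff[of "(p, 0)" "(zs, zs)" "(0, p)"] by simp
  ultimately show ?thesis
    by eventually_elim (simp add: right_diff_distrib sum_subtractf)
qed

lemma hess11_term:
  "AE \<omega> in M. (\<Sum>i\<in>UNIV. \<Sum>j\<in>UNIV. v $ i * v $ j *
       ms_deriv M (dir1 i) (ms_deriv M (dir1 j) (block_field u)) (zs, zs) \<omega>) =
     D2 (v, 0) (v, 0) (zs, zs) \<omega> - D2 (0, v) (0, v) (zs, zs) \<omega>"
proof -
  have "AE \<omega> in M. \<forall>i j. ms_deriv M (dir1 i) (ms_deriv M (dir1 j) (block_field u)) (zs, zs) \<omega> =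
      D2 (dir1 i) (dir1 j) (zs, zs) \<omega> - D2 (dir2 i) (dir2 j) (zs, zs) \<omega>"
    using ms_deriv2_block[of "dir1 _" "dir1 _" "(zs, zs)"] by (simp add: AE_all_countable)
  moreover have "AE \<omega> in M. (\<Sum>i\<in>UNIV. \<Sum>j\<in>UNIV. v $ i * v $ j * D2 (dir1 i) (dir1 j) (zs, zs) \<omega>) =
      D2 (v, 0) (v, 0) (zs, zs) \<omega>"
    using D2_sum[OF finite[of UNIV], of "\<lambda>i. v $ i" "\<lambda>i. v $ i" dir1 dir1 "(zs, zs)"] by (simp add: sum_dir1)
  moreover have "AE \<omega> in M. (\<Sum>i\<in>UNIV. \<Sum>j\<in>UNIV. v $ i * v $ j * D2 (dir2 i) (dir2 j) (zs, zs) \<omega>) =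
      D2 (0, v) (0, v) (zs, zs) \<omega>"
    using D2_sum[OF finite[of UNIV], of "\<lambda>i. v $ i" "\<lambda>i. v $ i" dir2 dir2 "(zs, zs)"] by (simp add: sum_dir2)
  ultimately show ?thesis
    by eventually_elim (simp add: right_diff_distrib sum_subtractf)
qed

lemma hess12_term:
  "AE \<omega> in M. (\<Sum>i\<in>UNIV. \<Sum>j\<in>UNIV. v $ i * w $ j *
       ms_deriv M (dir1 i) (ms_deriv M (dir2 j) (block_field u)) (zs, zs) \<omega>) =
     D2 (v, 0) (0, w) (zs, zs) \<omega> - D2 (0, v) (w, 0) (zs, zs) \<omega>"
proof -
  have "AE \<omega> in M. \<forall>i j. ms_deriv M (dir1 i) (ms_deriv M (dir2 j) (block_field u)) (zs, zs) \<omega> =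
      D2 (dir1 i) (dir2 j) (zs, zs) \<omega> - D2 (dir2 i) (dir1 j) (zs, zs) \<omega>"
    using ms_deriv2_block[of "dir1 _" "dir2 _" "(zs, zs)"] by (simp add: AE_all_countable)
  moreover have "AE \<omega> in M. (\<Sum>i\<in>UNIV. \<Sum>j\<in>UNIV. v $ i * w $ j * D2 (dir1 i) (dir2 j) (zs, zs) \<omega>) =
      D2 (v, 0) (0, w) (zs, zs) \<omega>"
    using D2_sum[OF finite[of UNIV], of "\<lambda>i. v $ i" "\<lambda>i. w $ i" dir1 dir2 "(zs, zs)"] by (simp add: sum_dir1 sum_dir2)
  moreover have "AE \<omega> in M. (\<Sum>i\<in>UNIV. \<Sum>j\<in>UNIV. v $ i * w $ j * D2 (dir2 i) (dir1 j) (zs, zs) \<omega>) =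
      D2 (0, v) (w, 0) (zs, zs) \<omega>"
    using D2_sum[OF finite[of UNIV], of "\<lambda>i. v $ i" "\<lambda>i. w $ i" dir2 dir1 "(zs, zs)"] by (simp add: sum_dir1 sum_dir2)
  ultimately show ?thesis
    by eventually_elim (simp add: right_diff_distrib sum_subtractf)
qed

text \<open>Formally, with \<open>p = (v, 0)\<close>, \<open>q = (w, 0)\<close> and their swaps \<open>p'\<close>, \<open>q'\<close>, this is the polynomial identity
\<open>(p - p' - q + q') (p + p' + q + q') = p\<^sup>2 - p'\<^sup>2 - q\<^sup>2 + q'\<^sup>2 + 2 p q' - 2 p' q\<close>.
It uses that second mean-square derivatives commute; that is contained in the symmetry of their
covariances.\<close>
lemma second_order_factorisation:
  "AE \<omega> in M. 1/2 * ((D2 (v, 0) (v, 0) z \<omega> - D2 (0, v) (0, v) z \<omega>) -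
         (D2 (w, 0) (w, 0) z \<omega> - D2 (0, w) (0, w) z \<omega>)) +
       (D2 (v, 0) (0, w) z \<omega> - D2 (0, v) (w, 0) z \<omega>) =
     1/2 * D2 (v - w, w - v) (v + w, v + w) z \<omega>"
proof -
  let ?Y = "\<lambda>\<omega>. (1/2 * ((D2 (v, 0) (v, 0) z \<omega> - D2 (0, v) (0, v) z \<omega>) -
         (D2 (w, 0) (w, 0) z \<omega> - D2 (0, w) (0, w) z \<omega>)) +
       (D2 (v, 0) (0, w) z \<omega> - D2 (0, v) (w, 0) z \<omega>)) -
     1/2 * D2 (v - w, w - v) (v + w, v + w) z \<omega>"
  have "AE \<omega> in M. ?Y \<omega> = 0"
  proof (rule D2_orthogonal_AE_zero)
    show "?Y \<in> l2_span (\<lambda>(a, b). D2 a b z)"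
      by (intro l2_span_diff l2_span_add l2_span_scale D2_in_span)
    fix c d :: "(real^'n) \<times> (real^'n)"
    obtain c1 c2 d1 d2 where cd: "c = (c1, c2)" "d = (d1, d2)" by (cases c, cases d)
    show "l2_inner M ?Y (D2 c d z) = 0"
      by (simp only: l2_inner_bilinear inner_D2_D2_same sq_D2 sq_integrable_diff sq_integrable_add
          sq_integrable_scale cd inner_Pair)
        (simp add: inner_add_left inner_add_right inner_diff_left inner_diff_right
          inner_commute[of w v] algebra_simps)
  qed
  then show ?thesis by simp
qed

text \<open>In the direction \<open>e = (v, w)\<close>, the block field has first derivative \<open>D\<^sub>e u - D\<^sub>e\<^sub>' u\<close> and second
derivative \<open>D\<^sub>e D\<^sub>e u - D\<^sub>e\<^sub>' D\<^sub>e\<^sub>' u = D\<^sub>a D\<^sub>b u\<close> at a point of the diagonal, where \<open>e'\<close> is the swap of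
\<open>e\<close>, \<open>a = e - e'\<close> and \<open>b = e + e'\<close>.\<close>
lemma skew_taylor2_eq:
  fixes zs x1 x2 v w :: "real^'n"
  defines "v \<equiv> x1 - zs" and "w \<equiv> x2 - zs"
  shows "AE \<omega> in M. skew_taylor2 M (block_field u) zs (x1, x2) \<omega> =
     D1 (v - w, w - v) (zs, zs) \<omega> + 1/2 * D2 (v - w, w - v) (v + w, v + w) (zs, zs) \<omega>"
  using gradient_term[of "v - w" zs] hess11_term[of v zs] hess11_term[of w zs] hess12_term[of v w zs]
    second_order_factorisation[of v "(zs, zs)" w]
  by eventually_elim (simp only: skew_taylor2_expand v_def[symmetric] w_def[symmetric] minus_diff_eq)

text \<open>By the preceding lemma the error is a combination of four variables whose covariances are known. As
\<open>a\<close> and \<open>b\<close> are orthogonal, only one of the three terms in the variance of \<open>D2 a b z\<close> survives.\<close>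
lemma taylor_error_moments:
  fixes zs x1 x2 v w :: "real^'n"
  defines "v \<equiv> x1 - zs" and "w \<equiv> x2 - zs"
  defines "E \<equiv> taylor_error M (block_field u) zs (x1, x2)"
  shows "E \<in> l2_closed_span M u"
    and "l2_inner M E E =
      2 * (h 0 - h (2 * (norm (v - w))\<^sup>2))
      - 4 * (h' 0 - 2 * h' ((norm v)\<^sup>2 + (norm w)\<^sup>2)) * (norm (v - w))\<^sup>2
      + 4 * (h'' 0 - 2 * h'' ((norm v)\<^sup>2 + (norm w)\<^sup>2)) * (norm (v - w))\<^sup>2 * (norm (v + w))\<^sup>2"
proof -
  let ?z = "(zs, zs)" and ?x = "(x1, x2)" and ?y = "(x2, x1)"
  define a b where "a = (v - w, w - v)" and "b = (v + w, v + w)"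
  let ?X = "\<lambda>\<omega>. (D1 a ?z \<omega> + 1/2 * D2 a b ?z \<omega>) - (u ?x \<omega> - u ?y \<omega>)"
  have X: "?X \<in> l2_closed_span M u"
    by (intro l2_closed_span_diff l2_closed_span_add l2_closed_span_scale sq_u D1_closed_span
        D2_closed_span l2_closed_span_base)
  have sqX: "sq_integrable M ?X" by (rule l2_closed_span_sq_integrable[OF X])
  have E: "E = (\<lambda>\<omega>. skew_taylor2 M (block_field u) zs (x1, x2) \<omega> - (u ?x \<omega> - u ?y \<omega>))"
    by (simp add: E_def taylor_error_def block_field_def fun_eq_iff)
  have sqE: "sq_integrable M E"
    unfolding E by (intro sq_integrable_diff sq_skew_taylor2 sq_u)
  have eq: "AE \<omega> in M. ?X \<omega> = E \<omega>"
    using skew_taylor2_eq[of zs x1 x2] unfolding v_def[symmetric] w_def[symmetric] a_def[symmetric] b_def[symmetric]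
    by eventually_elim (simp only: E)
  show "E \<in> l2_closed_span M u"
    by (rule l2_closed_span_cong_AE[OF sq_u X eq sq_integrable_measurable[OF sqE]])
  have aa: "a \<bullet> a = 2 * (norm (v - w))\<^sup>2" and bb: "b \<bullet> b = 2 * (norm (v + w))\<^sup>2" and ab: "a \<bullet> b = 0"
    by (simp_all add: a_def b_def power2_norm_eq_inner inner_simps inner_commute[of w v])
  have zx: "?z - ?x = (- v, - w)" "?z - ?y = (- w, - v)" by (simp_all add: v_def w_def)
  have nzx: "(norm (- v, - w))\<^sup>2 = (norm v)\<^sup>2 + (norm w)\<^sup>2"
    "(norm (- w, - v))\<^sup>2 = (norm v)\<^sup>2 + (norm w)\<^sup>2"
    by (simp_all add: power2_norm_eq_inner)
  have nxy: "(norm (?x - ?y))\<^sup>2 = 2 * (norm (v - w))\<^sup>2" "(norm (?y - ?x))\<^sup>2 = 2 * (norm (v - w))\<^sup>2"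
    by (simp_all add: power2_norm_eq_inner v_def w_def inner_simps inner_commute[of x2 x1])
  have xa: "(- v, - w) \<bullet> a = - (norm (v - w))\<^sup>2" "(- w, - v) \<bullet> a = (norm (v - w))\<^sup>2"
    and xb: "(- v, - w) \<bullet> b = - (norm (v + w))\<^sup>2" "(- w, - v) \<bullet> b = - (norm (v + w))\<^sup>2"
    by (simp_all add: a_def b_def power2_norm_eq_inner inner_simps inner_commute[of w v])
  let ?r = "(norm v)\<^sup>2 + (norm w)\<^sup>2" and ?p = "(norm (v - w))\<^sup>2" and ?q = "(norm (v + w))\<^sup>2"
  have m11: "l2_inner M (D1 a ?z) (D1 a ?z) = - 4 * h' 0 * ?p"
    by (simp add: inner_D1_D1 aa)
  have m22: "l2_inner M (D2 a b ?z) (D2 a b ?z) = 16 * h'' 0 * ?p * ?q"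
    by (simp add: inner_D2_D2_same aa bb ab inner_commute[of b a])
  have m12: "l2_inner M (D2 a b ?z) (D1 a ?z) = 0" "l2_inner M (D1 a ?z) (D2 a b ?z) = 0"
    by (simp_all add: inner_D2_D1_same l2_inner_commute[of M "D1 a ?z"])
  have m1u: "l2_inner M (D1 a ?z) (u ?x) = - 2 * h' ?r * ?p" "l2_inner M (D1 a ?z) (u ?y) = 2 * h' ?r * ?p"
    by (simp_all only: inner_D1_u zx nzx xa)
  have m2u: "l2_inner M (D2 a b ?z) (u ?x) = 4 * h'' ?r * ?p * ?q"
    "l2_inner M (D2 a b ?z) (u ?y) = - 4 * h'' ?r * ?p * ?q"
    by (simp_all only: inner_D2_u zx nzx xa xb ab)
  have muu: "l2_inner M (u ?x) (u ?x) = h 0" "l2_inner M (u ?y) (u ?y) = h 0"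
    "l2_inner M (u ?x) (u ?y) = h (2 * ?p)" "l2_inner M (u ?y) (u ?x) = h (2 * ?p)"
    by (simp_all only: cov_u nxy) simp_all
  have "l2_inner M E E = l2_inner M ?X ?X"
    by (rule l2_inner_cong_AE[symmetric, OF eq eq sqX sqE sqX sqE])
  also have "\<dots> = 2 * (h 0 - h (2 * ?p)) - 4 * (h' 0 - 2 * h' ?r) * ?p + 4 * (h'' 0 - 2 * h'' ?r) * ?p * ?q"
    by (simp only: l2_inner_bilinear sq_D1 sq_D2 sq_u sq_integrable_diff sq_integrable_add
        sq_integrable_scale l2_inner_commute[of M "u _" "D1 a ?z"] l2_inner_commute[of M "u _" "D2 a b ?z"]
        m11 m22 m12 m1u m2u muu) (simp add: algebra_simps)
  finally show "l2_inner M E E = 2 * (h 0 - h (2 * ?p)) - 4 * (h' 0 - 2 * h' ?r) * ?p + 4 * (h'' 0 - 2 * h'' ?r) * ?p * ?q" .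
qed

end

theorem proposition29:
  fixes M :: "'w measure"
    and u :: "(real^'n::finite) \<times> (real^'n) \<Rightarrow> 'w \<Rightarrow> real"
    and h h' h'' :: "real \<Rightarrow> real"
    and zs x1 x2 v w :: "real^'n"
    and E :: "'w \<Rightarrow> real"
  assumes "prob_space M"
    and "gaussian_field M u"
    and "\<And>x. prob_space.expectation M (u x) = 0"
    and "\<And>x y. covariance M (u x) (u y) = h ((norm (x - y))\<^sup>2)"
    and "cont_differentiable 4 (\<lambda>(x, y). covariance M (u x) (u y))"
    and "\<And>t. t \<ge> 0 \<Longrightarrow> (h has_real_derivative h' t) (at t within {0..})"
    and "\<And>t. t \<ge> 0 \<Longrightarrow> (h' has_real_derivative h'' t) (at t within {0..})"
    and "continuous_on {0..} h''"
  defines "E \<equiv> taylor_error M (block_field u) zs (x1, x2)"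
    and "v \<equiv> x1 - zs" and "w \<equiv> x2 - zs"
  shows "sq_integrable M E \<and>
         gaussian_rv M E \<and>
         prob_space.expectation M E = 0 \<and>
         prob_space.variance M E =
           2 * (h 0 - h (2 * (norm (v - w))\<^sup>2))
           - 4 * (h' 0 - 2 * h' ((norm v)\<^sup>2 + (norm w)\<^sup>2)) * (norm (v - w))\<^sup>2
           + 4 * (h'' 0 - 2 * h'' ((norm v)\<^sup>2 + (norm w)\<^sup>2))
               * (norm (v - w))\<^sup>2 * (norm (v + w))\<^sup>2"
proof -
  interpret prob_space M by fact
  have cov: "covariance M (u x) (u y) = l2_inner M (u x) (u y)" for x y
    by (simp add: covariance_def l2_inner_def assms(3))
  interpret block_isotropic_field M u h h' h''
  proof unfold_locales
    show "sq_integrable M (u x)" for x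
      by (rule gaussian_field_sq_integrable[OF assms(2)])
  qed (use assms(4-8) in \<open>simp_all add: cov\<close>)
  have E: "E \<in> l2_closed_span M u"
    unfolding E_def by (rule taylor_error_moments)
  have mean: "expectation E = 0"
    by (rule gaussian_closed_span(2)[OF assms(2,3) E])
  moreover have "variance E = l2_inner M E E"
    by (simp add: mean l2_inner_def power2_eq_square)
  ultimately show ?thesis
    using l2_closed_span_sq_integrable[OF E] gaussian_closed_span(1)[OF assms(2,3) E]
    by (simp only: E_def v_def w_def taylor_error_moments(2) simp_thms)
qed

end
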